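(* Let $p_0,p_1\in(0,\infty)$ and let $w_0,w_1$ be weights on $(0,\infty)$. Define $\psi_0,\psi_1\colon(0,\infty)\to[0,\infty]$ by $$\psi_i(t)=\left(\int_t^\infty s^{-p_i}w_i(s)\,ds\right)^{\frac1{p_i}}\quad\text{for }t\in(0,\infty),\ i\in\{0,1\}.$$ Assume that there exists a positive constant $C$ such that $$\psi_i(t)\le C\,\psi_i(2t)\quad\text{for all }t\in(0,\infty)\text{ and }i\in\{0,1\},$$ and that $w_0\in\mathrm{RB}_{p_0}$, that is, there exists a positive constant $C'$ such that $$\int_0^t w_0(s)\,ds\le C'\,t^{p_0}\int_t^\infty \frac{w_0(s)}{s^{p_0}}\,ds\quad\text{for all }t\in(0,\infty).$$ Then, for every $f\in\mathcal M(\mathcal R,\mu)$ satisfying $f^*\in A$ and every $t\in(0,\infty)$, $$K\big(f,t;S^{p_0}(w_0),S^{p_1}(w_1)\big)\approx K\big(Tf^*,t;\Lambda^{p_0}(\widetilde{w_0}),\Lambda^{p_1}(\widetilde{w_1})\big),$$ where $\widetilde{w_i}(s)=s^{p_i-2}w_i(1/s)$ for $s\in(0,\infty)$, and the constants of equivalence are independent of $f$ and $t$.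
   Context: $(\mathcal R,\mu)$ is a nonatomic $\sigma$-finite measure space with $\mu(\mathcal R)\in(0,\infty]$; $\mathcal M(\mathcal R,\mu)$ is the set of all $\mu$-measurable functions $\mathcal R\to[-\infty,\infty]$. A weight on $(0,\infty)$ is a nonnegative measurable function on $(0,\infty)$. The non-increasing rearrangement of $f$ is $f^*(t)=\inf\{\lambda\ge0:\mu(\{x:|f(x)|>\lambda\})\le t\}$, and $f^{**}(t)=\frac1t\int_0^tf^*(s)\,ds$. $L^1_{\rm loc}(0,\infty)$ is the set of functions integrable over every subset of $(0,\infty)$ of finite measure (in particular near $0$). $A$ is the set of all $g\in L^1_{\rm loc}(0,\infty)$ that are nonnegative, non-increasing and satisfy $\lim_{t\to\infty}g(t)=0$. The operator $T$ is $$Tg(t)=\int_0^{1/t}g(s)\,ds-\tfrac1t\,g(\tfrac1t),\quad t\in(0,\infty).$$ For $p\in(0,\infty)$ and a weight $w$: $\|f\|_{\Lambda^p(w)}=\left(\int_0^\infty f^*(t)^pw(t)\,dt\right)^{1/p}$ and $\|f\|_{S^p(w)}=\left(\int_0^\infty (f^{**}(t)-f^*(t))^pw(t)\,dt\right)^{1/p}$. $\Lambda^p(w)$ is the set of measurable $f$ with $\|f\|_{\Lambda^p(w)}<\infty$; $S^p(w)$ is the set of measurable $f$ with $\|f\|_{S^p(w)}<\infty$ and $\lim_{t\to\infty}f^*(t)=0$. These functionals need not be quasinorms. For a pair $(X_0,X_1)$ of such spaces over a common measure space, $K(f,t;X_0,X_1)=\inf\{\|f_0\|_{X_0}+t\|f_1\|_{X_1}: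 f=f_0+f_1,\ f_i\in X_i\}$ (with $\inf\emptyset=\infty$). On the left-hand side of the claim the spaces $S^{p_i}(w_i)$ are over $(\mathcal R,\mu)$; on the right-hand side the spaces $\Lambda^{p_i}(\widetilde{w_i})$ are over $(0,\infty)$ with Lebesgue measure. The relation $\approx$ means that each side is bounded by a constant multiple of the other. *)

theory Defs
  imports "HOL-Analysis.Analysis"
begin

definition nonatomic :: "'a measure \<Rightarrow> bool" where
  "nonatomic M \<longleftrightarrow> (\<forall>E\<in>sets M. 0 < emeasure M E \<longrightarrow>
     (\<exists>F\<in>sets M. F \<subseteq> E \<and> 0 < emeasure M F \<and> emeasure M F < emeasure M E))"

(* Only used for p > 0, where 0 is mapped to 0 and infinity to infinity. *)
definition ennpowr :: "ennreal \<Rightarrow> real \<Rightarrow> ennreal" where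
  "ennpowr x p = (if x = top then top else ennreal (enn2real x powr p))"

definition weight :: "(real \<Rightarrow> ennreal) \<Rightarrow> bool" where
  "weight w \<longleftrightarrow> w \<in> borel_measurable (lebesgue_on {0<..})"

(* The infimum of the empty set is infinity in ennreal. *)
definition rearr :: "'a measure \<Rightarrow> ('a \<Rightarrow> ereal) \<Rightarrow> real \<Rightarrow> ennreal" where
  "rearr M f t =
     Inf (ennreal ` {l. 0 \<le> l \<and> emeasure M {x \<in> space M. \<bar>f x\<bar> > ereal l} \<le> ennreal t})"

definition rearr_avg :: "'a measure \<Rightarrow> ('a \<Rightarrow> ereal) \<Rightarrow> real \<Rightarrow> ennreal" where
  "rearr_avg M f t = (\<integral>\<^sup>+ s\<in>{0<..<t}. rearr M f s \<partial>lebesgue) / ennreal t"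

(* The nonnegative members of the class of functions on the half-line that are integrable
   over every set of finite measure, including neighbourhoods of 0. *)
definition L1_loc_nonneg :: "(real \<Rightarrow> ennreal) set" where
  "L1_loc_nonneg = {g. g \<in> borel_measurable (lebesgue_on {0<..}) \<and>
     (\<forall>E\<in>sets lebesgue. E \<subseteq> {0<..} \<longrightarrow> emeasure lebesgue E < top \<longrightarrow>
        (\<integral>\<^sup>+ s\<in>E. g s \<partial>lebesgue) < top)}"

definition class_A :: "(real \<Rightarrow> ennreal) set" where
  "class_A = {g \<in> L1_loc_nonneg. antimono_on {0<..} g \<and> (g \<longlongrightarrow> 0) at_top}"

(* Both terms are finite for g in class_A, so the ereal subtraction is the one of the reals. *)
definition T_op :: "(real \<Rightarrow> ennreal) \<Rightarrow> real \<Rightarrow> ereal" where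
  "T_op g t = enn2ereal (\<integral>\<^sup>+ s\<in>{0<..<1 / t}. g s \<partial>lebesgue)
     - enn2ereal (ennreal (1 / t) * g (1 / t))"

definition Lambda_norm :: "'a measure \<Rightarrow> real \<Rightarrow> (real \<Rightarrow> ennreal) \<Rightarrow> ('a \<Rightarrow> ereal) \<Rightarrow> ennreal" where
  "Lambda_norm M p w f =
     ennpowr (\<integral>\<^sup>+ t\<in>{0<..}. ennpowr (rearr M f t) p * w t \<partial>lebesgue) (1 / p)"

(* The average dominates the rearrangement, so the ennreal subtraction never truncates;
   infinity minus infinity is infinity, that is, the integrand is infinite on the whole
   half-line if the rearrangement is not integrable near 0. *)
definition S_norm :: "'a measure \<Rightarrow> real \<Rightarrow> (real \<Rightarrow> ennreal) \<Rightarrow> ('a \<Rightarrow> ereal) \<Rightarrow> ennreal" where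
  "S_norm M p w f =
     ennpowr (\<integral>\<^sup>+ t\<in>{0<..}. ennpowr (rearr_avg M f t - rearr M f t) p * w t \<partial>lebesgue) (1 / p)"

definition Lambda_space :: "'a measure \<Rightarrow> real \<Rightarrow> (real \<Rightarrow> ennreal) \<Rightarrow> ('a \<Rightarrow> ereal) set" where
  "Lambda_space M p w = {f \<in> borel_measurable M. Lambda_norm M p w f < top}"

definition S_space :: "'a measure \<Rightarrow> real \<Rightarrow> (real \<Rightarrow> ennreal) \<Rightarrow> ('a \<Rightarrow> ereal) set" where
  "S_space M p w =
     {f \<in> borel_measurable M. S_norm M p w f < top \<and> (rearr M f \<longlongrightarrow> 0) at_top}"

(* f = f0 + f1 almost everywhere, where the sum must not be of the form infinity minus infinity. *)
definition decomposes ::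
  "'a measure \<Rightarrow> ('a \<Rightarrow> ereal) \<Rightarrow> ('a \<Rightarrow> ereal) \<Rightarrow> ('a \<Rightarrow> ereal) \<Rightarrow> bool" where
  "decomposes M f f0 f1 \<longleftrightarrow>
     (AE x in M. \<not> (\<bar>f0 x\<bar> = \<infinity> \<and> f1 x = - f0 x) \<and> f x = f0 x + f1 x)"

definition K_functional ::
  "'a measure \<Rightarrow> ('a \<Rightarrow> ereal) set \<Rightarrow> (('a \<Rightarrow> ereal) \<Rightarrow> ennreal) \<Rightarrow>
   ('a \<Rightarrow> ereal) set \<Rightarrow> (('a \<Rightarrow> ereal) \<Rightarrow> ennreal) \<Rightarrow> ('a \<Rightarrow> ereal) \<Rightarrow> real \<Rightarrow> ennreal" where
  "K_functional M X0 N0 X1 N1 f t =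
     Inf {N0 f0 + ennreal t * N1 f1 | f0 f1. f0 \<in> X0 \<and> f1 \<in> X1 \<and> decomposes M f f0 f1}"

definition K_S ::
  "'a measure \<Rightarrow> real \<Rightarrow> (real \<Rightarrow> ennreal) \<Rightarrow> real \<Rightarrow> (real \<Rightarrow> ennreal) \<Rightarrow> ('a \<Rightarrow> ereal) \<Rightarrow> real \<Rightarrow> ennreal"
  where
  "K_S M p0 w0 p1 w1 =
     K_functional M (S_space M p0 w0) (S_norm M p0 w0) (S_space M p1 w1) (S_norm M p1 w1)"

definition K_Lambda ::
  "'a measure \<Rightarrow> real \<Rightarrow> (real \<Rightarrow> ennreal) \<Rightarrow> real \<Rightarrow> (real \<Rightarrow> ennreal) \<Rightarrow> ('a \<Rightarrow> ereal) \<Rightarrow> real \<Rightarrow> ennreal"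
  where
  "K_Lambda M p0 w0 p1 w1 =
     K_functional M (Lambda_space M p0 w0) (Lambda_norm M p0 w0)
       (Lambda_space M p1 w1) (Lambda_norm M p1 w1)"

definition psi :: "real \<Rightarrow> (real \<Rightarrow> ennreal) \<Rightarrow> real \<Rightarrow> ennreal" where
  "psi p w t = ennpowr (\<integral>\<^sup>+ s\<in>{t<..}. ennreal (s powr (- p)) * w s \<partial>lebesgue) (1 / p)"

definition RB :: "real \<Rightarrow> (real \<Rightarrow> ennreal) set" where
  "RB p = {w. \<exists>C'::real. C' > 0 \<and> (\<forall>t>0.
     (\<integral>\<^sup>+ s\<in>{0<..<t}. w s \<partial>lebesgue)
       \<le> ennreal C' * ennreal (t powr p) * (\<integral>\<^sup>+ s\<in>{t<..}. w s / ennreal (s powr p) \<partial>lebesgue))}"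

definition tilde_weight :: "real \<Rightarrow> (real \<Rightarrow> ennreal) \<Rightarrow> real \<Rightarrow> ennreal" where
  "tilde_weight p w s = ennreal (s powr (p - 2)) * w (1 / s)"

end

theory Submission
  imports Defs
begin

text \<open>
  Write \<open>osc g u = \<integral>\<^sub>0\<^sup>u g - u g(u)\<close>, so that \<open>Tf*(1/u) = osc f* u\<close>; it is non-decreasing in \<open>u\<close>. With
  \<open>k(u) = u\<^sup>-\<^sup>p w(u)\<close> the \<open>p\<close>-th power of the S-norm of \<open>f\<close> is \<open>\<integral> (osc f* u)\<^sup>p k(u) du\<close>, the one of the
  Lambda-norm of \<open>h\<close> is \<open>\<integral> h*(1/u)\<^sup>p k(u) du\<close>, and \<open>\<psi>(t)\<^sup>p\<close> is the tail of \<open>k\<close>. Hence doubling of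
  \<open>\<psi>\<close> makes dilations of monotone functions harmless.

  If \<open>Tf* = h0 + h1\<close>, then \<open>osc f* u \<le> H0 u + H1 u\<close> with \<open>Hi u = hi*(1/(4u))\<close>. Cut \<open>f\<close> horizontally: the
  level \<open>y\<close> is given to the piece \<open>f0\<close> if \<open>H0 \<ge> H1\<close> at \<open>u = \<mu>(|f| > y)\<close> and to \<open>f1\<close> otherwise. Since
  \<open>osc f* u\<close> is the integral of \<open>\<mu>(|f| > y)\<close> over \<open>y \<ge> f*(u)\<close>, this gives \<open>osc fi* \<le> 2 Hi\<close>.

  If \<open>f = f0 + f1\<close>, then subadditivity of the rearrangement, used for \<open>f = f0 + f1\<close> and for \<open>f1 = f - f0\<close>,
  gives \<open>osc f* u \<le> 3 \<integral>\<^sub>0\<^sup>u f0* + 2 osc f1* (2u)\<close>. The first term is controlled by \<open>osc f0*\<close> because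
  \<open>\<integral>\<^sub>0\<^sup>u g \<le> \<Sum>n\<ge>1. 2\<^sup>-\<^sup>n osc g (2\<^sup>n u)\<close> and because RB improves itself to a geometric gain in the
  growth of the tails of \<open>k\<close>, which makes this series summable in norm.
\<close>

section \<open>Powers, monotone functions and tails of kernels\<close>

lemma ennpowr_ennreal: "0 \<le> x \<Longrightarrow> ennpowr (ennreal x) p = ennreal (x powr p)"
  by (simp add: ennpowr_def)

lemma ennpowr_top [simp]: "ennpowr top p = top"
  by (simp add: ennpowr_def)

lemma ennpowr_zero [simp]: "ennpowr 0 p = 0"
  by (simp add: ennpowr_def)

lemma ennpowr_mono:
  assumes "x \<le> y" "0 < p"
  shows "ennpowr x p \<le> ennpowr y p"
proof (cases y)
  case (real b)
  then obtain a where "0 \<le> a" "x = ennreal a"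
    using assms(1) by (cases x) (auto simp: top_unique)
  then show ?thesis
    using real assms by (auto simp: ennpowr_ennreal intro!: ennreal_leI powr_mono2)
qed simp

lemma ennpowr_mult:
  assumes "0 < p"
  shows "ennpowr (x * y) p = ennpowr x p * ennpowr y p"
proof -
  \<comment> \<open>Only an infinite factor needs care: its product with \<open>z\<close> is 0 or
    \<open>top\<close> according to whether \<open>z\<close> is 0, and powers keep these cases
    apart.\<close>
  have *: "ennpowr (top * z) p = top * ennpowr z p" for z
    by (cases z; cases "z = 0") (auto simp: ennpowr_ennreal ennreal_top_mult)
  show ?thesis
  proof (cases x)
    case (real a)
    show ?thesis
    proof (cases y)
      case (real b)
      then show ?thesis
        using \<open>0 \<le> a\<close> \<open>x = ennreal a\<close>
        by (simp add: ennpowr_ennreal powr_mult flip: ennreal_mult)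
    next
      case top
      then show ?thesis using *[of x] by (simp add: mult.commute)
    qed
  next
    case top
    then show ?thesis using * by simp
  qed
qed

lemma ennpowr_ennpowr: "ennpowr (ennpowr x p) q = ennpowr x (p * q)"
  by (cases x) (auto simp: ennpowr_ennreal powr_powr)

lemma ennpowr_1 [simp]: "ennpowr x 1 = x"
  by (cases x) (auto simp: ennpowr_ennreal)

lemma measurable_ennpowr [measurable]: "(\<lambda>x. ennpowr x p) \<in> borel_measurable borel"
  unfolding ennpowr_def by measurable

lemma ennpowr_le_cmult:
  assumes "x \<le> ennreal c * y" "0 < p" "0 \<le> c"
  shows "ennpowr x p \<le> ennreal (c powr p) * ennpowr y p"
  using ennpowr_mono[OF assms(1,2)] assms by (simp add: ennpowr_mult ennpowr_ennreal)

section \<open>Borel measurability of monotone functions\<close>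

lemma borel_measurable_mono_ennreal:
  fixes f :: "real \<Rightarrow> ennreal"
  assumes "mono f"
  shows "f \<in> borel_measurable borel"
proof (rule borel_measurableI_greater)
  fix y
  \<comment> \<open>Superlevel sets of a non-decreasing function are up-closed, hence
    intervals.\<close>
  have "is_interval (f -` {y<..})"
    unfolding is_interval_1 using assms by (auto simp: mono_def intro: less_le_trans)
  then show "{x \<in> space borel. y < f x} \<in> sets borel"
    using real_interval_borel_measurable by (auto simp: vimage_def)
qed

lemma borel_measurable_antimono_ennreal:
  fixes f :: "real \<Rightarrow> ennreal"
  assumes "antimono f"
  shows "f \<in> borel_measurable borel"
proof -
  have "mono (\<lambda>x. f (- x))"
    using assms by (auto simp: mono_def antimono_def)
  then have "(\<lambda>x. f (- (- x))) \<in> borel_measurable borel"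
    by (intro measurable_compose[OF _ borel_measurable_mono_ennreal[of "\<lambda>x. f (- x)"]]) auto
  then show ?thesis by simp
qed

text \<open>Since 0 is the least element of \<open>ennreal\<close>, cutting off to the left of 0
  preserves monotonicity on the whole line. The auxiliary functions \<open>J\<close> below are such
  cut-offs of functions whose behaviour is known only on the half-line.\<close>

lemma borel_measurable_mono_on_ennreal:
  fixes f :: "real \<Rightarrow> ennreal"
  assumes "mono_on {0<..} f"
  shows "(\<lambda>x. f x * indicator {0<..} x) \<in> borel_measurable borel"
  using assms
  by (intro borel_measurable_mono_ennreal) (auto simp: mono_def mono_on_def split: split_indicator)

section \<open>Comparison of integrals through tails\<close>

lemma nn_integral_atLeast_le_of_tails:
  fixes k :: "real \<Rightarrow> ennreal"
  assumes [measurable]: "k \<in> borel_measurable borel"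
    and tails: "\<And>b. a < b \<Longrightarrow> (\<integral>\<^sup>+ s\<in>{b<..}. k s \<partial>lborel) \<le> B"
  shows "(\<integral>\<^sup>+ s\<in>{a..}. k s \<partial>lborel) \<le> B"
proof -
  \<comment> \<open>The endpoint is a null set, and the open tails from \<open>a + 1 / Suc n\<close>
    increase to the open tail from \<open>a\<close>.\<close>
  have "(\<integral>\<^sup>+ s\<in>{a..}. k s \<partial>lborel) = (\<integral>\<^sup>+ s\<in>{a<..}. k s \<partial>lborel)"
  proof (rule nn_integral_cong_AE)
    show "AE s in lborel. k s * indicator {a..} s = k s * indicator {a<..} s"
      using AE_lborel_singleton[of a] by eventually_elim (auto split: split_indicator)
  qed
  also have "\<dots> = (\<integral>\<^sup>+ s. (SUP n. k s * indicator {a + 1 / Suc n<..} s) \<partial>lborel)"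
  proof (rule nn_integral_cong)
    fix s
    show "k s * indicator {a<..} s = (SUP n. k s * indicator {a + 1 / Suc n<..} s)"
    proof (cases "a < s")
      case True
      then obtain n where "1 / Suc n < s - a"
        using nat_approx_posE[of "s - a"] by auto
      then have "k s * indicator {a<..} s \<le> (SUP n. k s * indicator {a + 1 / Suc n<..} s)"
        using True by (intro SUP_upper2[of n]) auto
      moreover have "(SUP n. k s * indicator {a + 1 / Suc n<..} s) \<le> k s * indicator {a<..} s"
        using True by (intro SUP_least) (auto split: split_indicator)
      ultimately show ?thesis by (rule antisym)
    next
      case False
      moreover have "s \<notin> {a + 1 / Suc n<..}" for n :: nat
        using False by (auto simp: not_less intro: order_trans[of s a])
      ultimately show ?thesis by simp
    qed
  qed
  also have "\<dots> = (SUP n. \<integral>\<^sup>+ s\<in>{a + 1 / Suc n<..}. k s \<partial>lborel)"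
  proof (rule nn_integral_monotone_convergence_SUP)
    show "incseq (\<lambda>n s. k s * indicator {a + 1 / Suc n<..} s)"
    proof (intro incseq_SucI le_funI)
      fix n and s :: real
      have "1 / real (Suc (Suc n)) \<le> 1 / real (Suc n)"
        by (simp add: frac_le)
      then show "k s * indicator {a + 1 / Suc n<..} s \<le> k s * indicator {a + 1 / Suc (Suc n)<..} s"
        by (auto split: split_indicator)
    qed
  qed measurable
  also have "\<dots> \<le> B"
    by (intro SUP_least tails) auto
  finally show ?thesis .
qed

lemma nn_integral_ennreal_layers: "(\<integral>\<^sup>+ l. indicator {l. 0 \<le> l \<and> ennreal l < x} l \<partial>lborel) = x"
proof (cases x)
  case (real a)
  then have "{l. 0 \<le> l \<and> ennreal l < x} = {0..<a}"
    by (auto simp: ennreal_less_iff)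
  then show ?thesis using real by simp
next
  case top
  then have "{l. 0 \<le> l \<and> ennreal l < x} = {0..}" by auto
  moreover have "emeasure lborel {0::real..} = top"
  proof -
    have "of_nat n \<le> emeasure lborel {0::real..}" for n
      using emeasure_mono[of "{0..real n}" "{0..}" lborel] by (simp add: ennreal_of_nat_eq_real_of_nat)
    then show ?thesis
      using ennreal_SUP_of_nat_eq_top SUP_least top_unique by metis
  qed
  ultimately show ?thesis using top by simp
qed

text \<open>An up-closed subset of the half-line is a ray from its infimum, with or without the
  endpoint. The infimum may be 0, where no tail inequality is assumed, so the comparison passes
  through rays that start strictly to the right of it.\<close>

lemma up_closed_tail_comparison:
  fixes k1 k2 :: "real \<Rightarrow> ennreal"
  assumes [measurable]: "k1 \<in> borel_measurable borel" "k2 \<in> borel_measurable borel"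
    and tails: "\<And>t. 0 < t \<Longrightarrow>
      (\<integral>\<^sup>+ s\<in>{t<..}. k1 s \<partial>lborel) \<le> K * (\<integral>\<^sup>+ s\<in>{t<..}. k2 s \<partial>lborel)"
    and U: "U \<subseteq> {0<..}" "\<And>x y. x \<in> U \<Longrightarrow> x \<le> y \<Longrightarrow> y \<in> U"
  shows "(\<integral>\<^sup>+ s\<in>U. k1 s \<partial>lborel) \<le> K * (\<integral>\<^sup>+ s\<in>U. k2 s \<partial>lborel)"
proof (cases "U = {}")
  case False
  define a where "a = Inf U"
  have bdd: "bdd_below U" using U(1) by (auto intro!: bdd_belowI[of _ 0])
  have "0 \<le> a" using False U(1) unfolding a_def by (intro cInf_greatest) auto
  have up: "s \<in> U" if s: "a < s" for s
    using cInf_lessD[OF False, of s] U(2) s unfolding a_def by force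
  have "(\<integral>\<^sup>+ s\<in>U. k1 s \<partial>lborel) \<le> (\<integral>\<^sup>+ s\<in>{a..}. k1 s \<partial>lborel)"
    using cInf_lower[OF _ bdd]
    by (intro nn_integral_mono mult_left_mono) (auto simp: a_def split: split_indicator)
  also have "\<dots> \<le> K * (\<integral>\<^sup>+ s\<in>U. k2 s \<partial>lborel)"
  proof (rule nn_integral_atLeast_le_of_tails)
    fix b assume b: "a < b"
    have "(\<integral>\<^sup>+ s\<in>{b<..}. k1 s \<partial>lborel) \<le> K * (\<integral>\<^sup>+ s\<in>{b<..}. k2 s \<partial>lborel)"
      using b \<open>0 \<le> a\<close> by (intro tails) auto
    also have "\<dots> \<le> K * (\<integral>\<^sup>+ s\<in>U. k2 s \<partial>lborel)"
      using b by (intro mult_left_mono nn_integral_mono) (auto split: split_indicator intro: up)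
    finally show "(\<integral>\<^sup>+ s\<in>{b<..}. k1 s \<partial>lborel) \<le> K * (\<integral>\<^sup>+ s\<in>U. k2 s \<partial>lborel)" .
  qed simp
  finally show ?thesis .
qed simp

text \<open>The value \<open>H s\<close> is the length of the set of levels \<open>l\<close> with 0
  <= l < \<open>H s\<close>; Fubini exchanges the integrals over points and over levels.\<close>

lemma nn_integral_layer_cake:
  fixes k H :: "real \<Rightarrow> ennreal"
  assumes [measurable]: "k \<in> borel_measurable borel"
    and H: "(\<lambda>x. H x * indicator {0<..} x) \<in> borel_measurable borel"
  shows "(\<integral>\<^sup>+ s\<in>{0<..}. H s * k s \<partial>lborel) =
    (\<integral>\<^sup>+ l. (\<integral>\<^sup>+ s\<in>{s. 0 < s \<and> ennreal l < H s}. k s \<partial>lborel) * indicator {0..} l \<partial>lborel)"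
proof -
  define J where "J s = H s * indicator {0<..} s" for s
  have [measurable]: "J \<in> borel_measurable borel"
    using H by (simp add: J_def[abs_def])
  have "(\<integral>\<^sup>+ s\<in>{0<..}. H s * k s \<partial>lborel) = (\<integral>\<^sup>+ s. J s * k s \<partial>lborel)"
    by (auto intro!: nn_integral_cong simp: J_def split: split_indicator)
  also have "\<dots> = (\<integral>\<^sup>+ s. (\<integral>\<^sup>+ l. indicator {l. 0 \<le> l \<and> ennreal l < J s} l \<partial>lborel) * k s \<partial>lborel)"
    by (simp add: nn_integral_ennreal_layers)
  also have "\<dots> = (\<integral>\<^sup>+ s. (\<integral>\<^sup>+ l. (if 0 \<le> l \<and> ennreal l < J s then k s else 0) \<partial>lborel) \<partial>lborel)"
    by (subst nn_integral_multc[symmetric])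
       (auto intro!: nn_integral_cong split: split_indicator)
  also have "\<dots> = (\<integral>\<^sup>+ l. (\<integral>\<^sup>+ s. (if 0 \<le> l \<and> ennreal l < J s then k s else 0) \<partial>lborel) \<partial>lborel)"
    by (intro lborel_pair.Fubini') measurable
  also have "\<dots> = (\<integral>\<^sup>+ l. (\<integral>\<^sup>+ s\<in>{s. 0 < s \<and> ennreal l < H s}. k s \<partial>lborel) * indicator {0..} l \<partial>lborel)"
    by (intro nn_integral_cong) (auto simp: J_def split: split_indicator intro!: nn_integral_cong)
  finally show ?thesis .
qed

text \<open>Superlevel sets of a non-decreasing \<open>H\<close> are up-closed, so the tail
  inequality applies to each of them; integrating over the levels keeps the constant
  \<open>K\<close>.\<close>

lemma nn_integral_mono_tail_comparison:
  fixes k1 k2 H :: "real \<Rightarrow> ennreal"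
  assumes [measurable]: "k1 \<in> borel_measurable borel" "k2 \<in> borel_measurable borel"
    and tails: "\<And>t. 0 < t \<Longrightarrow>
      (\<integral>\<^sup>+ s\<in>{t<..}. k1 s \<partial>lborel) \<le> K * (\<integral>\<^sup>+ s\<in>{t<..}. k2 s \<partial>lborel)"
    and H: "mono_on {0<..} H"
  shows "(\<integral>\<^sup>+ s\<in>{0<..}. H s * k1 s \<partial>lborel) \<le> K * (\<integral>\<^sup>+ s\<in>{0<..}. H s * k2 s \<partial>lborel)"
proof -
  note Hm = borel_measurable_mono_on_ennreal[OF H]
  define J where "J s = H s * indicator {0<..} s" for s
  have [measurable]: "J \<in> borel_measurable borel"
    using Hm by (simp add: J_def[abs_def])
  have *: "(\<integral>\<^sup>+ s\<in>{s. 0 < s \<and> ennreal l < H s}. k2 s \<partial>lborel) * indicator {0..} l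
      = (\<integral>\<^sup>+ s. (if 0 \<le> l \<and> ennreal l < J s then k2 s else 0) \<partial>lborel)" for l
    by (auto simp: J_def split: split_indicator intro!: nn_integral_cong)
  have "(\<integral>\<^sup>+ s\<in>{0<..}. H s * k1 s \<partial>lborel) =
    (\<integral>\<^sup>+ l. (\<integral>\<^sup>+ s\<in>{s. 0 < s \<and> ennreal l < H s}. k1 s \<partial>lborel) * indicator {0..} l \<partial>lborel)"
    by (rule nn_integral_layer_cake[OF _ Hm]) simp
  also have "\<dots> \<le> (\<integral>\<^sup>+ l. K * ((\<integral>\<^sup>+ s\<in>{s. 0 < s \<and> ennreal l < H s}. k2 s \<partial>lborel) * indicator {0..} l) \<partial>lborel)"
  proof (rule nn_integral_mono)
    fix l
    have "(\<integral>\<^sup>+ s\<in>{s. 0 < s \<and> ennreal l < H s}. k1 s \<partial>lborel)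
        \<le> K * (\<integral>\<^sup>+ s\<in>{s. 0 < s \<and> ennreal l < H s}. k2 s \<partial>lborel)"
    proof (rule up_closed_tail_comparison[OF _ _ tails])
      fix x y assume "x \<in> {s. 0 < s \<and> ennreal l < H s}" "x \<le> y"
      moreover from this have "H x \<le> H y"
        using H by (auto simp: mono_on_def)
      ultimately show "y \<in> {s. 0 < s \<and> ennreal l < H s}" by auto
    qed auto
    then show "(\<integral>\<^sup>+ s\<in>{s. 0 < s \<and> ennreal l < H s}. k1 s \<partial>lborel) * indicator {0..} l
       \<le> K * ((\<integral>\<^sup>+ s\<in>{s. 0 < s \<and> ennreal l < H s}. k2 s \<partial>lborel) * indicator {0..} l)"
      by (auto split: split_indicator)
  qed
  also have "\<dots> = K * (\<integral>\<^sup>+ l. (\<integral>\<^sup>+ s\<in>{s. 0 < s \<and> ennreal l < H s}. k2 s \<partial>lborel) * indicator {0..} l \<partial>lborel)"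
    unfolding * by (rule nn_integral_cmult) measurable
  also have "\<dots> = K * (\<integral>\<^sup>+ s\<in>{0<..}. H s * k2 s \<partial>lborel)"
    by (subst nn_integral_layer_cake[OF _ Hm]) simp_all
  finally show ?thesis .
qed

text \<open>A substitution moves the dilation from \<open>H\<close> to the kernel: the tail of
  \<open>k'\<close> at \<open>t\<close> is the tail of \<open>k\<close> at \<open>t / a\<close>. It
  turns growth conditions on tails into norm bounds for dilated monotone functions, with
  \<open>a\<close> a power of 2 in every use.\<close>

lemma nn_integral_dilation_le:
  fixes k H :: "real \<Rightarrow> ennreal"
  assumes [measurable]: "k \<in> borel_measurable borel" and "0 < a"
    and tails: "\<And>t. 0 < t \<Longrightarrow>
      (\<integral>\<^sup>+ s\<in>{t<..}. k s \<partial>lborel) \<le> K * (\<integral>\<^sup>+ s\<in>{a * t<..}. k s \<partial>lborel)"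
    and H: "mono_on {0<..} H"
  shows "(\<integral>\<^sup>+ s\<in>{0<..}. H (a * s) * k s \<partial>lborel) \<le> K * (\<integral>\<^sup>+ s\<in>{0<..}. H s * k s \<partial>lborel)"
proof -
  define J where "J s = H s * indicator {0<..} s" for s
  have [measurable]: "J \<in> borel_measurable borel"
    using borel_measurable_mono_on_ennreal[OF H] by (simp add: J_def[abs_def])
  define k' where "k' s = ennreal (1 / a) * k (1 / a * s)" for s
  have [measurable]: "k' \<in> borel_measurable borel"
    unfolding k'_def by measurable
  have subst: "(\<integral>\<^sup>+ s. f (a * s) * k s \<partial>lborel) = (\<integral>\<^sup>+ s. f s * k' s \<partial>lborel)"
    if [measurable]: "f \<in> borel_measurable borel" for f :: "real \<Rightarrow> ennreal"
  proof -
    have "(\<integral>\<^sup>+ s. f (a * s) * k s \<partial>lborel)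
        = ennreal (1 / a) * (\<integral>\<^sup>+ s. f s * k (1 / a * s) \<partial>lborel)"
      using \<open>0 < a\<close> nn_integral_real_affine[of "\<lambda>s. f (a * s) * k s" "1 / a" 0] by simp
    also have "\<dots> = (\<integral>\<^sup>+ s. f s * k' s \<partial>lborel)"
      unfolding k'_def by (subst nn_integral_cmult[symmetric]) (auto simp: ac_simps)
    finally show ?thesis .
  qed
  have "(\<integral>\<^sup>+ s\<in>{0<..}. H (a * s) * k s \<partial>lborel) = (\<integral>\<^sup>+ s. J (a * s) * k s \<partial>lborel)"
    using \<open>0 < a\<close>
    by (auto intro!: nn_integral_cong simp: J_def zero_less_mult_iff split: split_indicator)
  also have "\<dots> = (\<integral>\<^sup>+ s. J s * k' s \<partial>lborel)"
    by (rule subst) simp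
  also have "\<dots> = (\<integral>\<^sup>+ s\<in>{0<..}. H s * k' s \<partial>lborel)"
    by (auto intro!: nn_integral_cong simp: J_def split: split_indicator)
  also have "\<dots> \<le> K * (\<integral>\<^sup>+ s\<in>{0<..}. H s * k s \<partial>lborel)"
  proof (rule nn_integral_mono_tail_comparison[OF _ _ _ H])
    fix t :: real assume t: "0 < t"
    have "(\<integral>\<^sup>+ s\<in>{t<..}. k' s \<partial>lborel) = (\<integral>\<^sup>+ s. indicator {t<..} (a * s) * k s \<partial>lborel)"
      by (subst subst) (auto simp: mult.commute)
    also have "\<dots> = (\<integral>\<^sup>+ s\<in>{t / a<..}. k s \<partial>lborel)"
      using \<open>0 < a\<close>
      by (auto intro!: nn_integral_cong simp: field_simps split: split_indicator)
    also have "\<dots> \<le> K * (\<integral>\<^sup>+ s\<in>{t<..}. k s \<partial>lborel)"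
      using tails[of "t / a"] \<open>0 < a\<close> t by simp
    finally show "(\<integral>\<^sup>+ s\<in>{t<..}. k' s \<partial>lborel) \<le> K * (\<integral>\<^sup>+ s\<in>{t<..}. k s \<partial>lborel)" .
  qed simp_all
  finally show ?thesis .
qed

section \<open>Rearrangements and oscillation\<close>

definition level_measure :: "'a measure \<Rightarrow> ('a \<Rightarrow> ereal) \<Rightarrow> real \<Rightarrow> ennreal" where
  "level_measure M f l = emeasure M {x \<in> space M. ereal l < \<bar>f x\<bar>}"

lemma antimono_level_measure:
  assumes [measurable]: "f \<in> borel_measurable M"
  shows "antimono (level_measure M f)"
proof
  fix x y :: real assume "x \<le> y"
  then show "level_measure M f y \<le> level_measure M f x"
    unfolding level_measure_def
    by (intro emeasure_mono) (auto intro: le_less_trans[of "ereal x" "ereal y"])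
qed

text \<open>The distribution function is continuous from the right, so the infimum in
  \<open>rearr\<close> is attained when it is finite. The resulting exchange of level and measure
  carries all later computations with rearrangements.\<close>

lemma rearr_le_iff:
  assumes [measurable]: "f \<in> borel_measurable M" and "0 \<le> l"
  shows "rearr M f t \<le> ennreal l \<longleftrightarrow> level_measure M f l \<le> ennreal t"
proof
  assume "level_measure M f l \<le> ennreal t"
  then show "rearr M f t \<le> ennreal l"
    using \<open>0 \<le> l\<close> unfolding rearr_def level_measure_def by (intro Inf_lower) auto
next
  assume le: "rearr M f t \<le> ennreal l"
  \<comment> \<open>Every level strictly above \<open>l\<close> lies above an admissible one.
    Letting it decrease to \<open>l\<close> uses continuity of the measure along increasing
    sets.\<close>
  have bound: "level_measure M f (l + 1 / Suc n) \<le> ennreal t" for n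
  proof -
    have "rearr M f t < ennreal (l + 1 / Suc n)"
      by (rule le_less_trans[OF le]) (use \<open>0 \<le> l\<close> in \<open>simp add: ennreal_less_iff\<close>)
    then obtain l' where l': "0 \<le> l'" "level_measure M f l' \<le> ennreal t" "l' < l + 1 / Suc n"
      unfolding rearr_def Inf_less_iff level_measure_def by (auto simp: ennreal_less_iff)
    then show ?thesis
      using antimonoD[OF antimono_level_measure[of f M], of l' "l + 1 / Suc n"] by simp
  qed
  have "level_measure M f l = emeasure M (\<Union>n. {x \<in> space M. ereal (l + 1 / Suc n) < \<bar>f x\<bar>})"
    unfolding level_measure_def
  proof (intro arg_cong[where f = "emeasure M"] set_eqI iffI)
    fix x assume x: "x \<in> {x \<in> space M. ereal l < \<bar>f x\<bar>}"
    then obtain r where r: "l < r" "ereal r < \<bar>f x\<bar>"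
      using ereal_dense2[of "ereal l" "\<bar>f x\<bar>"] by auto
    then obtain n where "1 / Suc n < r - l"
      using nat_approx_posE[of "r - l"] by auto
    then have "ereal (l + 1 / Suc n) < \<bar>f x\<bar>"
      using r(2) by (intro less_trans[OF _ r(2)]) auto
    then show "x \<in> (\<Union>n. {x \<in> space M. ereal (l + 1 / Suc n) < \<bar>f x\<bar>})"
      using x by auto
  next
    fix x assume "x \<in> (\<Union>n. {x \<in> space M. ereal (l + 1 / Suc n) < \<bar>f x\<bar>})"
    then obtain n where "x \<in> space M" "ereal (l + 1 / Suc n) < \<bar>f x\<bar>" by auto
    moreover have "ereal l \<le> ereal (l + 1 / Suc n)" by simp
    ultimately show "x \<in> {x \<in> space M. ereal l < \<bar>f x\<bar>}"
      using le_less_trans by blast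
  qed
  also have "\<dots> = (SUP n. emeasure M {x \<in> space M. ereal (l + 1 / Suc n) < \<bar>f x\<bar>})"
  proof (rule SUP_emeasure_incseq[symmetric])
    show "incseq (\<lambda>n. {x \<in> space M. ereal (l + 1 / Suc n) < \<bar>f x\<bar>})"
    proof (rule incseq_SucI)
      fix n
      have "ereal (l + 1 / Suc (Suc n)) \<le> ereal (l + 1 / Suc n)"
        by (simp add: frac_le)
      then show "{x \<in> space M. ereal (l + 1 / Suc n) < \<bar>f x\<bar>}
          \<subseteq> {x \<in> space M. ereal (l + 1 / Suc (Suc n)) < \<bar>f x\<bar>}"
        using le_less_trans by blast
    qed
  qed auto
  also have "\<dots> \<le> ennreal t"
    using bound by (intro SUP_least) (simp add: level_measure_def)
  finally show "level_measure M f l \<le> ennreal t" .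
qed

lemma less_rearr_iff:
  assumes "f \<in> borel_measurable M" and "0 \<le> l"
  shows "ennreal l < rearr M f t \<longleftrightarrow> ennreal t < level_measure M f l"
  using rearr_le_iff[OF assms, of t] by (simp add: not_le[symmetric])

lemma antimono_rearr: "antimono (rearr M f)"
proof
  fix s t :: real assume "s \<le> t"
  then show "rearr M f t \<le> rearr M f s"
    unfolding rearr_def
    by (intro Inf_superset_mono image_mono) (auto intro: order_trans ennreal_leI)
qed

lemma measurable_rearr [measurable]: "rearr M f \<in> borel_measurable borel"
  by (rule borel_measurable_antimono_ennreal[OF antimono_rearr])

text \<open>Let \<open>a\<close> and \<open>b\<close> be the two rearrangements on the right. The
  sets where |g| > a and |h| > b have measure at most \<open>s\<close> and \<open>t\<close>, and
  almost everywhere outside both of them |f| <= a + b.\<close>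

lemma rearr_add_le:
  assumes [measurable]: "f \<in> borel_measurable M" "g \<in> borel_measurable M" "h \<in> borel_measurable M"
    and le: "AE x in M. \<bar>f x\<bar> \<le> \<bar>g x\<bar> + \<bar>h x\<bar>" and st: "0 < s" "0 < t"
  shows "rearr M f (s + t) \<le> rearr M g s + rearr M h t"
proof (cases "rearr M g s = top \<or> rearr M h t = top")
  case False
  then obtain a b where ab: "0 \<le> a" "rearr M g s = ennreal a" "0 \<le> b" "rearr M h t = ennreal b"
    by (metis ennreal_cases)
  have "level_measure M f (a + b)
      \<le> emeasure M ({x \<in> space M. ereal a < \<bar>g x\<bar>} \<union> {x \<in> space M. ereal b < \<bar>h x\<bar>})"
    unfolding level_measure_def
  proof (rule emeasure_mono_AE)
    show "AE x in M. x \<in> {x \<in> space M. ereal (a + b) < \<bar>f x\<bar>} \<longrightarrow>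
        x \<in> {x \<in> space M. ereal a < \<bar>g x\<bar>} \<union> {x \<in> space M. ereal b < \<bar>h x\<bar>}"
      using le
    proof eventually_elim
      case (elim x)
      have "\<bar>g x\<bar> + \<bar>h x\<bar> \<le> ereal (a + b)" if "\<bar>g x\<bar> \<le> ereal a" "\<bar>h x\<bar> \<le> ereal b"
        using add_mono[OF that] by simp
      then show ?case using elim by (metis (mono_tags, lifting) Un_iff mem_Collect_eq not_less order_trans)
    qed
  qed measurable
  also have "\<dots> \<le> level_measure M g a + level_measure M h b"
    unfolding level_measure_def by (rule emeasure_subadditive) measurable
  also have "\<dots> \<le> ennreal s + ennreal t"
    using ab by (intro add_mono) (auto simp: rearr_le_iff[symmetric])
  also have "\<dots> = ennreal (s + t)"
    using st by simp
  finally show ?thesis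
    using ab by (simp add: rearr_le_iff[symmetric] flip: ennreal_plus)
qed auto

section \<open>Oscillation of non-increasing functions\<close>

text \<open>For a non-increasing \<open>g\<close> this is \<open>u (g** u - g u)\<close>; it is infinite if \<open>g\<close> is not
  integrable near 0.\<close>
definition osc :: "(real \<Rightarrow> ennreal) \<Rightarrow> real \<Rightarrow> ennreal" where
  "osc g u = (\<integral>\<^sup>+ s\<in>{0<..<u}. g s \<partial>lborel) - ennreal u * g u"

lemma rearr_avg_minus_rearr:
  assumes "0 < u"
  shows "rearr_avg M f u - rearr M f u = ennreal (1 / u) * osc (rearr M f) u"
proof -
  have "ennreal (1 / u) * (ennreal u * rearr M f u) = rearr M f u"
    using assms by (simp add: mult.assoc[symmetric] flip: ennreal_mult)
  moreover have "x / ennreal u = ennreal (1 / u) * x" for x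
    using assms by (simp add: divide_ennreal_def inverse_ennreal mult.commute inverse_eq_divide)
  ultimately show ?thesis
    unfolding rearr_avg_def osc_def nn_integral_completion
    by (simp add: ennreal_right_diff_distrib)
qed

text \<open>Between \<open>u\<close> and \<open>v\<close> the function is at least
  \<open>g v\<close>.\<close>

lemma add_interval_le_nn_integral:
  assumes g: "antimono g" and uv: "0 \<le> u" "u \<le> v"
  shows "(\<integral>\<^sup>+ s\<in>{0<..<u}. g s \<partial>lborel) + ennreal (v - u) * g v \<le> (\<integral>\<^sup>+ s\<in>{0<..<v}. g s \<partial>lborel)"
proof -
  note [measurable] = borel_measurable_antimono_ennreal[OF g]
  have "(\<integral>\<^sup>+ s\<in>{0<..<u}. g s \<partial>lborel) + ennreal (v - u) * g v
      = (\<integral>\<^sup>+ s\<in>{0<..<u}. g s \<partial>lborel) + (\<integral>\<^sup>+ s\<in>{u<..<v}. g v \<partial>lborel)"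
    using uv by (simp add: nn_integral_cmult mult.commute)
  also have "\<dots> = (\<integral>\<^sup>+ s. g s * indicator {0<..<u} s + g v * indicator {u<..<v} s \<partial>lborel)"
    by (rule nn_integral_add[symmetric]) measurable
  also have "\<dots> \<le> (\<integral>\<^sup>+ s\<in>{0<..<v}. g s \<partial>lborel)"
    using g uv by (intro nn_integral_mono) (auto simp: antimono_def split: split_indicator)
  finally show ?thesis .
qed

lemma mult_le_nn_integral:
  assumes "antimono g" "0 \<le> u"
  shows "ennreal u * g u \<le> (\<integral>\<^sup>+ s\<in>{0<..<u}. g s \<partial>lborel)"
  using add_interval_le_nn_integral[OF assms(1), of 0 u] assms(2) by simp

lemma nn_integral_eq_osc:
  assumes "antimono g" "0 \<le> u"
  shows "(\<integral>\<^sup>+ s\<in>{0<..<u}. g s \<partial>lborel) = osc g u + ennreal u * g u"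
  unfolding osc_def using diff_add_cancel_ennreal[OF mult_le_nn_integral[OF assms]] by simp

text \<open>Passing from \<open>u\<close> to \<open>v\<close> adds at least (v - u) g(v) to the
  integral, so the oscillation at \<open>v\<close> is at least the integral up to \<open>u\<close>
  minus u g(v), and g(v) <= g(u). The inequality is proved after adding the finite term v g(v),
  which avoids truncated subtraction.\<close>

lemma mono_on_osc:
  assumes g: "antimono g"
  shows "mono_on {0<..} (osc g)"
proof (rule mono_onI)
  fix u v :: real assume uv: "u \<in> {0<..}" "v \<in> {0<..}" "u \<le> v"
  show "osc g u \<le> osc g v"
  proof (cases "(\<integral>\<^sup>+ s\<in>{0<..<v}. g s \<partial>lborel) = top")
    case True
    then show ?thesis by (simp add: osc_def)
  next
    case False
    have le: "(\<integral>\<^sup>+ s\<in>{0<..<u}. g s \<partial>lborel) + ennreal (v - u) * g v \<le> (\<integral>\<^sup>+ s\<in>{0<..<v}. g s \<partial>lborel)"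
      using uv by (intro add_interval_le_nn_integral[OF g]) auto
    have fin: "ennreal v * g v \<noteq> top"
      using mult_le_nn_integral[OF g, of v] False uv by (auto simp: top_unique)
    have "osc g u + ennreal v * g v \<le> osc g u + ennreal u * g u + ennreal (v - u) * g v"
    proof -
      have "ennreal v * g v = ennreal u * g v + ennreal (v - u) * g v"
        using uv by (simp add: distrib_right[symmetric] flip: ennreal_plus)
      also have "\<dots> \<le> ennreal u * g u + ennreal (v - u) * g v"
        using g uv by (intro add_right_mono mult_left_mono) (auto simp: antimono_def)
      finally show ?thesis by (simp add: add.assoc add_left_mono)
    qed
    also have "\<dots> \<le> osc g v + ennreal v * g v"
      using le uv by (simp add: nn_integral_eq_osc[OF g])
    finally show ?thesis
      using fin by (simp add: ennreal_add_left_cancel_le add.commute)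
  qed
qed

text \<open>Halving the argument bounds the integral of \<open>g\<close> by integrals of
  \<open>g0\<close> and \<open>g1\<close> up to \<open>u / 2\<close>. The second one equals an
  oscillation of \<open>g1\<close> up to a multiple of g1(2u), and bounding g1(2u) through
  \<open>g\<close> and \<open>g0\<close> produces exactly the term u g(u) that
  \<open>osc g u\<close> subtracts.\<close>

lemma osc_subadditive:
  assumes g: "antimono g" and g0: "antimono g0" and g1: "antimono g1" and "0 < u"
    and fin: "(\<integral>\<^sup>+ s\<in>{0<..<u}. g s \<partial>lborel) < top"
    and g_le: "\<And>s t. 0 < s \<Longrightarrow> 0 < t \<Longrightarrow> g (s + t) \<le> g0 s + g1 t"
    and g1_le: "\<And>s t. 0 < s \<Longrightarrow> 0 < t \<Longrightarrow> g1 (s + t) \<le> g s + g0 t"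
  shows "osc g u \<le> 3 * (\<integral>\<^sup>+ s\<in>{0<..<u}. g0 s \<partial>lborel) + 2 * osc g1 (2 * u)"
proof (cases "osc g1 (2 * u) = top")
  case True
  then show ?thesis by (simp add: ennreal_mult_top)
next
  case osc_fin: False
  note [measurable] = g[THEN borel_measurable_antimono_ennreal]
    g0[THEN borel_measurable_antimono_ennreal] g1[THEN borel_measurable_antimono_ennreal]
  let ?I0 = "\<integral>\<^sup>+ s\<in>{0<..<u}. g0 s \<partial>lborel"
  let ?b = "g1 (2 * u)"
  have half: "(\<integral>\<^sup>+ s\<in>{0<..<u}. h (s / 2) \<partial>lborel) = 2 * (\<integral>\<^sup>+ s\<in>{0<..<u / 2}. h s \<partial>lborel)"
    if [measurable]: "h \<in> borel_measurable borel" for h :: "real \<Rightarrow> ennreal"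
  proof -
    have "(\<integral>\<^sup>+ s\<in>{0<..<u}. h (s / 2) \<partial>lborel)
        = ennreal 2 * (\<integral>\<^sup>+ s. h s * indicator {0<..<u} (2 * s) \<partial>lborel)"
      using nn_integral_real_affine[of "\<lambda>s. h (s / 2) * indicator {0<..<u} s" 2 0] by simp
    also have "(\<integral>\<^sup>+ s. h s * indicator {0<..<u} (2 * s) \<partial>lborel) = (\<integral>\<^sup>+ s\<in>{0<..<u / 2}. h s \<partial>lborel)"
      by (intro nn_integral_cong) (auto split: split_indicator)
    finally show ?thesis by simp
  qed
  have b_fin: "ennreal (2 * u) * ?b \<noteq> top"
  proof -
    have "(\<integral>\<^sup>+ s\<in>{0<..<2 * u}. g1 s \<partial>lborel) \<noteq> top"
      using osc_fin by (auto simp: osc_def)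
    then show ?thesis
      using mult_le_nn_integral[OF g1, of "2 * u"] \<open>0 < u\<close> by (auto simp: top_unique)
  qed
  \<comment> \<open>The interval from \<open>u / 2\<close> to \<open>2 * u\<close> contributes at
    least 3/2 u g1(2u). Of the 2 u g1(2u) that separates the integral from the oscillation, one half
    of u g1(2u) remains, and doubling makes it u g1(2u).\<close>
  have I1: "2 * (\<integral>\<^sup>+ s\<in>{0<..<u / 2}. g1 s \<partial>lborel) \<le> 2 * osc g1 (2 * u) + ennreal u * ?b"
  proof -
    have "(\<integral>\<^sup>+ s\<in>{0<..<u / 2}. g1 s \<partial>lborel) + ennreal (2 * u - u / 2) * ?b
        \<le> osc g1 (2 * u) + ennreal (2 * u) * ?b"
      using add_interval_le_nn_integral[OF g1, of "u / 2" "2 * u"] \<open>0 < u\<close>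
      by (simp add: nn_integral_eq_osc[OF g1])
    also have "\<dots> = osc g1 (2 * u) + ennreal (u / 2) * ?b + ennreal (2 * u - u / 2) * ?b"
      using \<open>0 < u\<close> by (simp add: add.assoc distrib_right[symmetric] flip: ennreal_plus)
    finally have "(\<integral>\<^sup>+ s\<in>{0<..<u / 2}. g1 s \<partial>lborel) \<le> osc g1 (2 * u) + ennreal (u / 2) * ?b"
      using b_fin \<open>0 < u\<close> by (auto simp: ennreal_add_left_cancel_le add.commute ennreal_mult_eq_top_iff)
    then have "2 * (\<integral>\<^sup>+ s\<in>{0<..<u / 2}. g1 s \<partial>lborel) \<le> 2 * (osc g1 (2 * u) + ennreal (u / 2) * ?b)"
      by (rule mult_left_mono) simp
    also have "\<dots> = 2 * osc g1 (2 * u) + ennreal 2 * ennreal (u / 2) * ?b"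
      by (simp add: distrib_left mult.assoc)
    also have "ennreal 2 * ennreal (u / 2) = ennreal u"
      using \<open>0 < u\<close> by (subst ennreal_mult[symmetric]) auto
    finally show ?thesis .
  qed
  have "(\<integral>\<^sup>+ s\<in>{0<..<u}. g s \<partial>lborel)
      \<le> (\<integral>\<^sup>+ s. g0 (s / 2) * indicator {0<..<u} s + g1 (s / 2) * indicator {0<..<u} s \<partial>lborel)"
  proof (rule nn_integral_mono)
    fix s :: real
    show "g s * indicator {0<..<u} s \<le> g0 (s / 2) * indicator {0<..<u} s + g1 (s / 2) * indicator {0<..<u} s"
      using g_le[of "s / 2" "s / 2"] by (auto split: split_indicator)
  qed
  also have "\<dots> = 2 * (\<integral>\<^sup>+ s\<in>{0<..<u / 2}. g0 s \<partial>lborel) + 2 * (\<integral>\<^sup>+ s\<in>{0<..<u / 2}. g1 s \<partial>lborel)"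
    by (subst nn_integral_add) (auto simp: half)
  also have "\<dots> \<le> 2 * ?I0 + (2 * osc g1 (2 * u) + ennreal u * ?b)"
    using \<open>0 < u\<close>
    by (intro add_mono mult_left_mono nn_integral_mono I1) (auto split: split_indicator)
  \<comment> \<open>The reverse inequality for \<open>g1\<close> enters at \<open>s = t = u\<close>.
    The term u g(u) cancels at the end, and u g0(u) is absorbed into a third copy of
    \<open>?I0\<close>.\<close>
  also have "\<dots> \<le> 2 * ?I0 + (2 * osc g1 (2 * u) + ennreal u * (g u + g0 u))"
    using g1_le[of u u] \<open>0 < u\<close> by (intro add_left_mono mult_left_mono) simp_all
  also have "\<dots> = 2 * ?I0 + 2 * osc g1 (2 * u) + ennreal u * g u + ennreal u * g0 u"
    by (simp add: algebra_simps)
  also have "\<dots> \<le> 2 * ?I0 + 2 * osc g1 (2 * u) + ennreal u * g u + ?I0"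
    using mult_le_nn_integral[OF g0, of u] \<open>0 < u\<close> by (intro add_left_mono) auto
  also have "\<dots> = ennreal u * g u + ((2 * ?I0 + ?I0) + 2 * osc g1 (2 * u))"
    by (simp add: algebra_simps)
  also have "2 * ?I0 + ?I0 = 3 * ?I0"
    using distrib_right[of 2 1 ?I0] by simp
  finally show ?thesis
    unfolding osc_def[of g] using fin by (auto simp: ennreal_minus_le_iff)
qed

text \<open>Let G be the integral of \<open>g\<close> from 0. Then G(u) + u g(2u) <= G(2u). After
  doubling this, one copy of G(2u) is written as the oscillation plus 2u g(2u), and the terms with
  g(2u) cancel.\<close>

lemma nn_integral_double_le_osc:
  assumes g: "antimono g" and "0 < u"
  shows "(\<integral>\<^sup>+ s\<in>{0<..<u}. g s \<partial>lborel)
    \<le> ennreal (1 / 2) * osc g (2 * u) + ennreal (1 / 2) * (\<integral>\<^sup>+ s\<in>{0<..<2 * u}. g s \<partial>lborel)"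
proof (cases "(\<integral>\<^sup>+ s\<in>{0<..<2 * u}. g s \<partial>lborel) = top")
  case True
  then show ?thesis by (simp add: ennreal_mult_top)
next
  case False
  let ?G = "\<lambda>u. \<integral>\<^sup>+ s\<in>{0<..<u}. g s \<partial>lborel"
  let ?b = "g (2 * u)"
  have b_fin: "ennreal (2 * u) * ?b \<noteq> top"
    using mult_le_nn_integral[OF g, of "2 * u"] \<open>0 < u\<close> False by (auto simp: top_unique)
  have two: "ennreal (1 / 2) * (2 * x) = x" for x
    using ennreal_mult[of "1 / 2" 2] by (simp add: mult.assoc[symmetric])
  have "2 * (?G u + ennreal u * ?b) \<le> 2 * ?G (2 * u)"
    using add_interval_le_nn_integral[OF g, of u "2 * u"] \<open>0 < u\<close>
    by (intro mult_left_mono) auto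
  also have "2 * (?G u + ennreal u * ?b) = 2 * ?G u + ennreal (2 * u) * ?b"
    using \<open>0 < u\<close> by (simp add: distrib_left mult.assoc ennreal_mult)
  also have "2 * ?G (2 * u) = ?G (2 * u) + ?G (2 * u)"
    by (rule mult_2)
  also have "\<dots> = ?G (2 * u) + osc g (2 * u) + ennreal (2 * u) * ?b"
    using nn_integral_eq_osc[OF g, of "2 * u"] \<open>0 < u\<close> by (simp add: add.assoc)
  finally have "2 * ?G u \<le> ?G (2 * u) + osc g (2 * u)"
    using b_fin by (simp add: ennreal_add_left_cancel_le add.commute)
  then have "ennreal (1 / 2) * (2 * ?G u) \<le> ennreal (1 / 2) * (?G (2 * u) + osc g (2 * u))"
    by (rule mult_left_mono) simp
  then show ?thesis by (simp only: two distrib_left add.commute)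
qed

text \<open>Iterating the doubling inequality leaves a remainder equal to \<open>u\<close> times the
  average of \<open>g\<close> over an interval of length 2^N u. It vanishes in the limit because
  \<open>g\<close> tends to 0.\<close>

lemma nn_integral_le_suminf_osc:
  assumes g: "antimono g" and lim: "(g \<longlongrightarrow> 0) at_top" and "0 < u"
  shows "(\<integral>\<^sup>+ s\<in>{0<..<u}. g s \<partial>lborel)
    \<le> (\<Sum>n. ennreal ((1 / 2) ^ Suc n) * osc g (2 ^ Suc n * u))"
proof -
  let ?G = "\<lambda>u. \<integral>\<^sup>+ s\<in>{0<..<u}. g s \<partial>lborel"
  let ?a = "\<lambda>n. ennreal ((1 / 2) ^ Suc n) * osc g (2 ^ Suc n * u)"
  have partial: "?G u \<le> (\<Sum>n<N. ?a n) + ennreal ((1 / 2) ^ N) * ?G (2 ^ N * u)" for N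
  proof (induction N)
    case (Suc N)
    have *: "ennreal ((1 / 2) ^ N) * (ennreal (1 / 2) * x) = ennreal ((1 / 2) ^ Suc N) * x" for x
      by (subst mult.assoc[symmetric], subst ennreal_mult[symmetric]) (auto simp: mult.commute)
    have "ennreal ((1 / 2) ^ N) * ?G (2 ^ N * u) \<le> ennreal ((1 / 2) ^ N) *
        (ennreal (1 / 2) * osc g (2 * (2 ^ N * u)) + ennreal (1 / 2) * ?G (2 * (2 ^ N * u)))"
      using \<open>0 < u\<close> by (intro mult_left_mono nn_integral_double_le_osc[OF g]) auto
    also have "\<dots> = ?a N + ennreal ((1 / 2) ^ Suc N) * ?G (2 ^ Suc N * u)"
      by (simp only: distrib_left * power_Suc mult.assoc)
    finally have "(\<Sum>n<N. ?a n) + ennreal ((1 / 2) ^ N) * ?G (2 ^ N * u)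
        \<le> (\<Sum>n<Suc N. ?a n) + ennreal ((1 / 2) ^ Suc N) * ?G (2 ^ Suc N * u)"
      unfolding sum.lessThan_Suc add.assoc by (rule add_left_mono)
    with Suc show ?case by (rule order_trans)
  qed simp
  show ?thesis
  proof (cases "\<exists>a>0. ?G a = top")
    case True
    then obtain a where a: "0 < a" "?G a = top" by auto
    obtain n where "a / u < 2 ^ n"
      using real_arch_pow[of 2 "a / u"] by auto
    then have "a \<le> 2 ^ Suc n * u"
      using \<open>0 < u\<close> a(1) by (auto simp: field_simps)
    then have "?G a \<le> ?G (2 ^ Suc n * u)"
      by (intro nn_integral_mono) (auto split: split_indicator)
    \<comment> \<open>In \<open>ennreal\<close> the difference \<open>top - x\<close> is
      \<open>top\<close> for every \<open>x\<close>, so an infinite integral makes the oscillation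
      infinite.\<close>
    then have "?a n = top"
      using a(2) by (simp add: top_unique osc_def ennreal_mult_top)
    then have "(\<Sum>n. ?a n) = top"
      using sum_le_suminf[OF summableI, of "{n}" ?a] by (simp add: top_unique)
    then show ?thesis by simp
  next
    case False
    \<comment> \<open>Beyond \<open>a\<close> the function is at most \<open>g a\<close>. For fixed
      \<open>a\<close> the first term disappears as \<open>N\<close> grows; afterwards
      \<open>a\<close> tends to infinity and removes the second.\<close>
    have tail: "ennreal ((1 / 2) ^ N) * ?G (2 ^ N * u) \<le> ennreal ((1 / 2) ^ N) * ?G a + ennreal u * g a"
      if "0 < a" for a N
    proof -
      note [measurable] = borel_measurable_antimono_ennreal[OF g]
      have "?G (2 ^ N * u) \<le> (\<integral>\<^sup>+ s. g s * indicator {0<..<a} s + g a * indicator {0<..<2 ^ N * u} s \<partial>lborel)"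
        using g by (intro nn_integral_mono) (auto simp: antimono_def split: split_indicator)
      also have "\<dots> = ?G a + ennreal (2 ^ N * u) * g a"
        using \<open>0 < u\<close> by (subst nn_integral_add) (auto simp: nn_integral_cmult mult.commute)
      finally have "ennreal ((1 / 2) ^ N) * ?G (2 ^ N * u)
          \<le> ennreal ((1 / 2) ^ N) * (?G a + ennreal (2 ^ N * u) * g a)"
        by (rule mult_left_mono) simp
      also have "\<dots> = ennreal ((1 / 2) ^ N) * ?G a + ennreal u * g a"
      proof -
        have "ennreal ((1 / 2) ^ N) * (ennreal (2 ^ N * u) * g a)
            = ennreal ((1 / 2) ^ N * (2 ^ N * u)) * g a"
          using \<open>0 < u\<close> by (subst mult.assoc[symmetric], subst ennreal_mult[symmetric]) auto
        also have "(1 / 2) ^ N * (2 ^ N * u) = u"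
          by (simp add: power_one_over)
        finally show ?thesis by (simp add: distrib_left)
      qed
      finally show ?thesis .
    qed
    have le: "?G u \<le> (\<Sum>n. ?a n) + ennreal u * g a" if "0 < a" for a
    proof (rule LIMSEQ_le_const)
      have "(\<lambda>N. ennreal ((1 / 2) ^ N)) \<longlonglongrightarrow> ennreal 0"
        by (intro tendsto_ennrealI LIMSEQ_power_zero) auto
      then have "(\<lambda>N. ?G a * ennreal ((1 / 2) ^ N)) \<longlonglongrightarrow> ?G a * ennreal 0"
        using False that by (intro ennreal_tendsto_cmult) (auto simp: less_top)
      then have "(\<lambda>N. ennreal ((1 / 2) ^ N) * ?G a) \<longlonglongrightarrow> 0 * ?G a"
        by (simp add: mult.commute)
      then have "(\<lambda>N. (\<Sum>n. ?a n) + (ennreal ((1 / 2) ^ N) * ?G a + ennreal u * g a))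
          \<longlonglongrightarrow> (\<Sum>n. ?a n) + (0 * ?G a + ennreal u * g a)"
        by (intro tendsto_add tendsto_const)
      then show "(\<lambda>N. (\<Sum>n. ?a n) + (ennreal ((1 / 2) ^ N) * ?G a + ennreal u * g a))
          \<longlonglongrightarrow> (\<Sum>n. ?a n) + ennreal u * g a"
        by simp
      show "\<exists>N. \<forall>n\<ge>N. ?G u \<le> (\<Sum>n. ?a n) + (ennreal ((1 / 2) ^ n) * ?G a + ennreal u * g a)"
      proof (intro exI allI impI)
        fix n
        show "?G u \<le> (\<Sum>n. ?a n) + (ennreal ((1 / 2) ^ n) * ?G a + ennreal u * g a)"
          by (rule order_trans[OF partial[of n]]) (intro add_mono sum_le_suminf tail that summableI; simp)
      qed
    qed
    have "((\<lambda>a. (\<Sum>n. ?a n) + ennreal u * g a) \<longlongrightarrow> (\<Sum>n. ?a n) + ennreal u * 0) at_top"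
      by (intro tendsto_add tendsto_const ennreal_tendsto_cmult lim) simp
    moreover have "\<forall>\<^sub>F a in at_top. ?G u \<le> (\<Sum>n. ?a n) + ennreal u * g a"
      using eventually_gt_at_top[of 0] by eventually_elim (rule le)
    ultimately have "?G u \<le> (\<Sum>n. ?a n) + ennreal u * 0"
      by (rule tendsto_lowerbound) simp
    then show ?thesis by simp
  qed
qed

section \<open>The norms as integrals against a Borel kernel\<close>

lemma nn_integral_positive_reals_SUP:
  fixes f :: "real \<Rightarrow> ennreal"
  assumes [measurable]: "f \<in> borel_measurable borel"
  shows "(\<integral>\<^sup>+ x\<in>{0<..}. f x \<partial>lborel) = (SUP n. \<integral>\<^sup>+ x\<in>{1 / (real n + 2)..real n + 2}. f x \<partial>lborel)"
proof -
  \<comment> \<open>These intervals are invariant under inversion; the summand 2 keeps the right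
    endpoint above 1.\<close>
  have "(\<Union>n. {1 / (real n + 2)..real n + 2}) = {0<..}"
  proof (intro set_eqI iffI)
    fix x :: real assume "x \<in> {0<..}"
    moreover obtain n :: nat where "max x (1 / x) < real n"
      using reals_Archimedean2 by blast
    ultimately show "x \<in> (\<Union>n. {1 / (real n + 2)..real n + 2})"
      by (intro UN_I[of n]) (auto simp: field_simps)
  next
    fix x assume "x \<in> (\<Union>n. {1 / (real n + 2)..real n + 2})"
    then obtain n where "1 / (real n + 2) \<le> x" by auto
    moreover have "0 < 1 / (real n + 2)" by simp
    ultimately show "x \<in> {0<..}" unfolding greaterThan_iff by linarith
  qed
  moreover have "incseq (\<lambda>n. {1 / (real n + 2)..real n + 2})"
    by (rule incseq_SucI) (auto intro: order_trans[rotated] simp: frac_le)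
  ultimately have "(SUP n. emeasure (density lborel f) {1 / (real n + 2)..real n + 2})
      = emeasure (density lborel f) {0<..}"
    by (subst SUP_emeasure_incseq) auto
  then show ?thesis by (simp add: emeasure_density)
qed

lemma nn_integral_inversion:
  fixes f :: "real \<Rightarrow> ennreal"
  assumes [measurable]: "f \<in> borel_measurable borel"
  shows "(\<integral>\<^sup>+ x\<in>{0<..}. f x \<partial>lborel) = (\<integral>\<^sup>+ x\<in>{0<..}. f (1 / x) * ennreal (1 / x\<^sup>2) \<partial>lborel)"
proof -
  have "(\<integral>\<^sup>+ x\<in>{1 / c..c}. f x \<partial>lborel) = (\<integral>\<^sup>+ x\<in>{1 / c..c}. f (1 / x) * ennreal (1 / x\<^sup>2) \<partial>lborel)"
    if c: "1 < c" for c
  proof -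
    have "1 / c < c"
      using c by (simp add: field_simps less_1_mult)
    \<comment> \<open>The map -1/x is increasing with derivative 1/x^2, so a preliminary reflection
      turns inversion into an increasing substitution.\<close>
    have "(\<integral>\<^sup>+ x\<in>{1 / c..c}. f x \<partial>lborel)
        = (\<integral>\<^sup>+ x. f (- x) * indicator {- 1 / (1 / c)..- 1 / c} x \<partial>lborel)"
      by (subst nn_integral_real_affine[where c = "-1" and t = 0])
         (auto intro!: nn_integral_cong split: split_indicator simp: field_simps)
    also have "\<dots> = (\<integral>\<^sup>+ x. f (- (- 1 / x)) * ennreal (1 / x\<^sup>2) * indicator {1 / c..c} x \<partial>lborel)"
    proof (rule nn_integral_substitution_aux[where f = "\<lambda>x. f (- x)" and g = "\<lambda>x. - 1 / x"])
      fix x assume "x \<in> {1 / c..c}"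
      moreover have "0 < 1 / c" using c by simp
      ultimately have "0 < x" unfolding atLeastAtMost_iff by linarith
      then show "((\<lambda>x. - 1 / x) has_real_derivative 1 / x\<^sup>2) (at x)"
        by (auto intro!: derivative_eq_intros simp: power2_eq_square)
    next
      have "0 < 1 / c" using c by simp
      then have "0 \<notin> {1 / c..c}" unfolding atLeastAtMost_iff by linarith
      then show "continuous_on {1 / c..c} (\<lambda>x. 1 / x\<^sup>2)"
        by (intro continuous_intros) auto
    qed (use \<open>1 / c < c\<close> in auto)
    finally show ?thesis by simp
  qed
  then have "(SUP n. \<integral>\<^sup>+ x\<in>{1 / (real n + 2)..real n + 2}. f x \<partial>lborel)
      = (SUP n. \<integral>\<^sup>+ x\<in>{1 / (real n + 2)..real n + 2}. f (1 / x) * ennreal (1 / x\<^sup>2) \<partial>lborel)"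
    by simp
  then show ?thesis by (simp add: nn_integral_positive_reals_SUP)
qed

text \<open>Inversion preserves null sets: the change of variables is applied to the indicator of a
  null set containing the exceptional points.\<close>

lemma AE_inversion:
  assumes "AE x in lborel. 0 < x \<longrightarrow> P x"
  shows "AE x in lborel. 0 < x \<longrightarrow> P (1 / x :: real)"
proof -
  from assms obtain N where N: "{x. \<not> (0 < x \<longrightarrow> P x)} \<subseteq> N" "N \<in> sets lborel" "emeasure lborel N = 0"
    by (auto elim!: AE_E)
  have [measurable]: "N \<in> sets borel" using N(2) by simp
  have "(\<integral>\<^sup>+ x\<in>{0<..}. indicator N (1 / x) * ennreal (1 / x\<^sup>2) \<partial>lborel)
      = (\<integral>\<^sup>+ x\<in>{0<..}. indicator N x \<partial>lborel)"
    by (rule nn_integral_inversion[symmetric]) simp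
  also have "\<dots> \<le> (\<integral>\<^sup>+ x. indicator N x \<partial>lborel)"
    by (intro nn_integral_mono) (auto split: split_indicator)
  also have "\<dots> = 0" using N by simp
  finally have "AE x in lborel. indicator N (1 / x) * ennreal (1 / x\<^sup>2) * indicator {0<..} x = 0"
    by (subst nn_integral_0_iff_AE[symmetric]) auto
  then show ?thesis
  proof eventually_elim
    case (elim x)
    show ?case
    proof
      assume "0 < x"
      then have "1 / x \<notin> N" using elim by auto
      then show "P (1 / x)" using N(1) \<open>0 < x\<close> zero_less_divide_1_iff[of x] by blast
    qed
  qed
qed

section \<open>Weights as Borel kernels\<close>

text \<open>Weights are only Lebesgue measurable; \<open>k\<close> is a Borel representative.\<close>
definition kernel :: "real \<Rightarrow> (real \<Rightarrow> ennreal) \<Rightarrow> (real \<Rightarrow> ennreal) \<Rightarrow> bool" where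
  "kernel p w k \<longleftrightarrow> k \<in> borel_measurable borel \<and>
     (AE u in lborel. 0 < u \<longrightarrow> k u = ennreal (u powr - p) * w u)"

lemma kernel_exists:
  assumes "weight w"
  obtains k where "kernel p w k"
proof -
  have "(\<lambda>x. w x * indicator {0<..} x) \<in> borel_measurable lebesgue"
    using assms unfolding weight_def by (subst (asm) borel_measurable_restrict_space_iff_ennreal) auto
  then obtain w' where [measurable]: "w' \<in> borel_measurable borel"
    and w': "AE x in lborel. w x * indicator {0<..} x = w' x"
    using completion_ex_borel_measurable[of "\<lambda>x. w x * indicator {0<..} x" lborel] by auto
  have "AE u in lborel. 0 < u \<longrightarrow> ennreal (u powr - p) * w' u = ennreal (u powr - p) * w u"
    using w' by eventually_elim auto
  then have "kernel p w (\<lambda>u. ennreal (u powr - p) * w' u)"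
    by (simp add: kernel_def)
  then show thesis by (rule that)
qed

text \<open>The difference of average and rearrangement is the oscillation divided by
  \<open>u\<close>; the factor u^(-p) that this leaves is part of the kernel.\<close>

lemma S_norm_kernel:
  assumes k: "kernel p w k" and "0 < p"
  shows "S_norm M p w f =
    ennpowr (\<integral>\<^sup>+ u\<in>{0<..}. ennpowr (osc (rearr M f) u) p * k u \<partial>lborel) (1 / p)"
proof -
  have "AE u in lborel. 0 < u \<longrightarrow> k u = ennreal (u powr - p) * w u"
    using k by (simp add: kernel_def)
  then have "AE u in lborel. ennpowr (rearr_avg M f u - rearr M f u) p * w u * indicator {0<..} u
      = ennpowr (osc (rearr M f) u) p * k u * indicator {0<..} u"
  proof eventually_elim
    case (elim u)
    show ?case
    proof (cases "0 < u")
      case True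
      then have "ennpowr (rearr_avg M f u - rearr M f u) p
          = ennreal (u powr - p) * ennpowr (osc (rearr M f) u) p"
        using \<open>0 < p\<close>
        by (simp add: rearr_avg_minus_rearr ennpowr_mult ennpowr_ennreal powr_divide powr_minus_divide)
      with True elim show ?thesis by (simp add: ac_simps)
    qed simp
  qed
  then have "(\<integral>\<^sup>+ u\<in>{0<..}. ennpowr (rearr_avg M f u - rearr M f u) p * w u \<partial>lborel)
      = (\<integral>\<^sup>+ u\<in>{0<..}. ennpowr (osc (rearr M f) u) p * k u \<partial>lborel)"
    by (rule nn_integral_cong_AE)
  then show ?thesis by (simp add: S_norm_def nn_integral_completion)
qed

text \<open>Inversion turns k(u) du into k(1/u) u^(-2) du, and k(1/u) u^(-2) = u^(p-2) w(1/u) is the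
  transformed weight. Both norms thus become integrals of non-decreasing functions against the same
  kernel.\<close>

lemma Lambda_norm_kernel:
  assumes k: "kernel p w k" and "0 < p"
  shows "Lambda_norm N p (tilde_weight p w) h =
    ennpowr (\<integral>\<^sup>+ u\<in>{0<..}. ennpowr (rearr N h (1 / u)) p * k u \<partial>lborel) (1 / p)"
proof -
  have [measurable]: "k \<in> borel_measurable borel" and ae: "AE u in lborel. 0 < u \<longrightarrow> k u = ennreal (u powr - p) * w u"
    using k by (auto simp: kernel_def)
  have "(\<integral>\<^sup>+ u\<in>{0<..}. ennpowr (rearr N h (1 / u)) p * k u \<partial>lborel)
      = (\<integral>\<^sup>+ u\<in>{0<..}. ennpowr (rearr N h (1 / (1 / u))) p * k (1 / u) * ennreal (1 / u\<^sup>2) \<partial>lborel)"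
    by (rule nn_integral_inversion) measurable
  also have "\<dots> = (\<integral>\<^sup>+ u\<in>{0<..}. ennpowr (rearr N h u) p * tilde_weight p w u \<partial>lborel)"
  proof (rule nn_integral_cong_AE)
    show "AE u in lborel. ennpowr (rearr N h (1 / (1 / u))) p * k (1 / u) * ennreal (1 / u\<^sup>2) * indicator {0<..} u
      = ennpowr (rearr N h u) p * tilde_weight p w u * indicator {0<..} u"
      using AE_inversion[OF ae]
    proof eventually_elim
      case (elim u)
      show ?case
      proof (cases "0 < u")
        case True
        have "ennreal ((1 / u) powr - p) * ennreal (1 / u\<^sup>2) = ennreal (u powr (p - 2))"
          using True
          by (simp add: powr_divide powr_minus_divide powr_diff flip: ennreal_mult)
        then have "k (1 / u) * ennreal (1 / u\<^sup>2) = tilde_weight p w u"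
          using True elim unfolding tilde_weight_def by (simp add: ac_simps)
        then show ?thesis by (simp add: mult.assoc)
      qed simp
    qed
  qed
  finally show ?thesis by (simp add: Lambda_norm_def nn_integral_completion)
qed

lemma psi_kernel:
  assumes k: "kernel p w k" and "0 \<le> t"
  shows "psi p w t = ennpowr (\<integral>\<^sup>+ s\<in>{t<..}. k s \<partial>lborel) (1 / p)"
proof -
  have "AE u in lborel. 0 < u \<longrightarrow> k u = ennreal (u powr - p) * w u"
    using k by (simp add: kernel_def)
  then have "AE u in lborel. ennreal (u powr - p) * w u * indicator {t<..} u = k u * indicator {t<..} u"
    by eventually_elim (use \<open>0 \<le> t\<close> in \<open>auto split: split_indicator\<close>)
  then show ?thesis
    unfolding psi_def nn_integral_completion by (simp cong: nn_integral_cong_AE)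
qed

lemma psi_doubling_kernel:
  assumes k: "kernel p w k" and "0 < p" "0 < C" "0 < t"
    and le: "psi p w t \<le> ennreal C * psi p w (2 * t)"
  shows "(\<integral>\<^sup>+ s\<in>{t<..}. k s \<partial>lborel) \<le> ennreal (C powr p) * (\<integral>\<^sup>+ s\<in>{2 * t<..}. k s \<partial>lborel)"
  using ennpowr_le_cmult[OF le \<open>0 < p\<close>] assms
  by (simp add: psi_kernel[OF k] ennpowr_ennpowr)

text \<open>The weight is recovered as s^p k(s), so the condition compares a truncated moment of the
  kernel with its tail.\<close>

lemma RB_kernel:
  assumes k: "kernel p w k" and "w \<in> RB p"
  obtains C where "0 < C" "\<And>t. 0 < t \<Longrightarrow> (\<integral>\<^sup>+ s\<in>{0<..<t}. ennreal (s powr p) * k s \<partial>lborel)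
    \<le> ennreal (C * t powr p) * (\<integral>\<^sup>+ s\<in>{t<..}. k s \<partial>lborel)"
proof -
  have ae: "AE u in lborel. 0 < u \<longrightarrow> k u = ennreal (u powr - p) * w u"
    using k by (simp add: kernel_def)
  from assms(2) obtain C where "0 < C" and C: "\<And>t. 0 < t \<Longrightarrow> (\<integral>\<^sup>+ s\<in>{0<..<t}. w s \<partial>lborel)
       \<le> ennreal C * ennreal (t powr p) * (\<integral>\<^sup>+ s\<in>{t<..}. w s / ennreal (s powr p) \<partial>lborel)"
    unfolding RB_def nn_integral_completion by auto
  have eq: "ennreal (s powr p) * k s = w s" "w s / ennreal (s powr p) = k s"
    if "0 < s" "k s = ennreal (s powr - p) * w s" for s
  proof -
    have "ennreal (s powr p) * ennreal (s powr - p) = 1"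
      using that by (simp add: powr_minus field_simps flip: ennreal_mult)
    then show "ennreal (s powr p) * k s = w s"
      using that by (simp add: mult.assoc[symmetric])
    show "w s / ennreal (s powr p) = k s"
      using that by (simp add: divide_ennreal_def inverse_ennreal powr_minus mult.commute)
  qed
  have "(\<integral>\<^sup>+ s\<in>{0<..<t}. ennreal (s powr p) * k s \<partial>lborel)
    \<le> ennreal (C * t powr p) * (\<integral>\<^sup>+ s\<in>{t<..}. k s \<partial>lborel)" if "0 < t" for t
  proof -
    have "(\<integral>\<^sup>+ s\<in>{0<..<t}. ennreal (s powr p) * k s \<partial>lborel) = (\<integral>\<^sup>+ s\<in>{0<..<t}. w s \<partial>lborel)"
    proof (rule nn_integral_cong_AE)
      show "AE s in lborel. ennreal (s powr p) * k s * indicator {0<..<t} s = w s * indicator {0<..<t} s"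
        using ae
      proof eventually_elim
        case (elim s)
        then show ?case using eq(1)[of s] by (cases "s \<in> {0<..<t}") auto
      qed
    qed
    moreover have "(\<integral>\<^sup>+ s\<in>{t<..}. w s / ennreal (s powr p) \<partial>lborel) = (\<integral>\<^sup>+ s\<in>{t<..}. k s \<partial>lborel)"
    proof (rule nn_integral_cong_AE)
      show "AE s in lborel. w s / ennreal (s powr p) * indicator {t<..} s = k s * indicator {t<..} s"
        using ae by eventually_elim (use that in \<open>simp add: eq split: split_indicator\<close>)
    qed
    ultimately show ?thesis
      using C[OF that] \<open>0 < C\<close> by (simp add: ennreal_mult)
  qed
  with \<open>0 < C\<close> show thesis by (rule that)
qed

section \<open>The reverse doubling condition\<close>

text \<open>The reverse doubling condition improves itself: \<open>V t = \<integral> min u t ^ p k(u) du\<close> is comparable to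
  \<open>t ^ p\<close> times the tail of \<open>k\<close>, and its increment from \<open>t\<close> to \<open>2t\<close> is a fixed fraction of \<open>V (2t)\<close>.\<close>
lemma reverse_doubling_tails:
  fixes k :: "real \<Rightarrow> ennreal"
  assumes [measurable]: "k \<in> borel_measurable borel" and "0 < p" "0 < C"
    and RB: "\<And>t. 0 < t \<Longrightarrow> (\<integral>\<^sup>+ s\<in>{0<..<t}. ennreal (s powr p) * k s \<partial>lborel)
      \<le> ennreal (C * t powr p) * (\<integral>\<^sup>+ s\<in>{t<..}. k s \<partial>lborel)"
  obtains \<theta> where "0 < \<theta>" "\<theta> < 1" "\<And>t n. 0 < t \<Longrightarrow> (\<integral>\<^sup>+ s\<in>{t<..}. k s \<partial>lborel)
      \<le> ennreal ((C + 1) * (\<theta> * 2 powr p) ^ n) * (\<integral>\<^sup>+ s\<in>{2 ^ n * t<..}. k s \<partial>lborel)"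
proof -
  let ?\<Psi> = "\<lambda>t. \<integral>\<^sup>+ s\<in>{t<..}. k s \<partial>lborel"
  define V where "V t = (\<integral>\<^sup>+ s\<in>{0<..<t}. ennreal (s powr p) * k s \<partial>lborel) + ennreal (t powr p) * ?\<Psi> t" for t
  \<comment> \<open>Chosen so that \<eta> (C + 1) 2^p = 2^p - 1: this matches the upper bound for
    \<open>V (2 * t)\<close> with its increment in \<open>V_step\<close>.\<close>
  define \<eta> where "\<eta> = (2 powr p - 1) / ((C + 1) * 2 powr p)"
  have "1 < (2::real) powr p" using \<open>0 < p\<close> by simp
  then have \<eta>: "0 < \<eta>" "\<eta> < 1"
  proof -
    show "0 < \<eta>" unfolding \<eta>_def using \<open>0 < C\<close> \<open>1 < 2 powr p\<close> by (intro divide_pos_pos mult_pos_pos) auto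
    have "1 * 2 powr p < (C + 1) * 2 powr p"
      using \<open>0 < C\<close> by (intro mult_strict_right_mono) auto
    then have "2 powr p - 1 < (C + 1) * 2 powr p" by linarith
    moreover have "0 < (C + 1) * 2 powr p" using \<open>0 < C\<close> by simp
    ultimately show "\<eta> < 1" unfolding \<eta>_def by (simp only: divide_less_eq_1_pos)
  qed
  have V_le: "V t \<le> ennreal ((C + 1) * t powr p) * ?\<Psi> t" if "0 < t" for t
  proof -
    have "V t \<le> ennreal (C * t powr p) * ?\<Psi> t + ennreal (t powr p) * ?\<Psi> t"
      unfolding V_def using RB[OF that] by (rule add_right_mono)
    also have "\<dots> = (ennreal (C * t powr p) + ennreal (t powr p)) * ?\<Psi> t"
      by (simp only: distrib_right)
    also have "ennreal (C * t powr p) + ennreal (t powr p) = ennreal ((C + 1) * t powr p)"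
      using \<open>0 < C\<close> by (subst ennreal_plus[symmetric]) (auto simp: algebra_simps)
    finally show ?thesis .
  qed
  have V_eq: "V t = (\<integral>\<^sup>+ s. ennreal (s powr p) * k s * indicator {0<..<t} s
      + ennreal (t powr p) * (k s * indicator {t<..} s) \<partial>lborel)" for t
    unfolding V_def by (subst nn_integral_add) (auto simp: nn_integral_cmult)
  \<comment> \<open>The integrand of \<open>V\<close> is min(s, t)^p k(s). Passing from
    \<open>t\<close> to \<open>2 * t\<close> adds exactly (2^p - 1) t^p k(s) for s > 2t and a
    nonnegative amount elsewhere.\<close>
  have V_step: "V t + ennreal ((2 powr p - 1) * t powr p) * ?\<Psi> (2 * t) \<le> V (2 * t)" if "0 < t" for t
  proof -
    have "V t + ennreal ((2 powr p - 1) * t powr p) * ?\<Psi> (2 * t)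
      = (\<integral>\<^sup>+ s. ennreal (s powr p) * k s * indicator {0<..<t} s
          + ennreal (t powr p) * (k s * indicator {t<..} s)
          + ennreal ((2 powr p - 1) * t powr p) * (k s * indicator {2 * t<..} s) \<partial>lborel)"
      unfolding V_eq
      by (subst (2) nn_integral_add) (auto simp: nn_integral_cmult)
    also have "\<dots> \<le> V (2 * t)"
      unfolding V_eq
    proof (rule nn_integral_mono_AE)
      have sum: "ennreal (t powr p) + ennreal ((2 powr p - 1) * t powr p) = ennreal ((2 * t) powr p)"
        using \<open>1 < 2 powr p\<close> that
        by (subst ennreal_plus[symmetric]) (auto simp: algebra_simps powr_mult)
      have mono: "ennreal (t powr p) * x \<le> ennreal (s powr p) * x" if "t \<le> s" for s x
        using that \<open>0 < t\<close> \<open>0 < p\<close> by (intro mult_right_mono ennreal_leI powr_mono2) auto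
      show "AE s in lborel. ennreal (s powr p) * k s * indicator {0<..<t} s
          + ennreal (t powr p) * (k s * indicator {t<..} s)
          + ennreal ((2 powr p - 1) * t powr p) * (k s * indicator {2 * t<..} s)
        \<le> ennreal (s powr p) * k s * indicator {0<..<2 * t} s
          + ennreal ((2 * t) powr p) * (k s * indicator {2 * t<..} s)"
        \<comment> \<open>The point \<open>2 * t\<close> lies in neither interval on the right and
          is discarded as a null set.\<close>
        using AE_lborel_singleton[of "2 * t"]
      proof eventually_elim
        case (elim s)
        consider "s \<le> t" | "t < s" "s < 2 * t" | "2 * t < s" using elim by fastforce
        then show ?case
        proof cases
          case 1
          then show ?thesis using that by (auto split: split_indicator)
        next
          case 2
          then show ?thesis using that mono[of s "k s"] by auto
        next
          case 3
          then show ?thesis using that by (auto simp: distrib_right[symmetric] sum)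
        qed
      qed
    qed
    finally show ?thesis .
  qed
  \<comment> \<open>By the choice of \<eta> the increment is at least \<eta> V(2t), so V(t) + \<eta>
    V(2t) <= V(2t). The infinite case is separate because \<eta> V(2t) is cancelled.\<close>
  have V_contract: "V t \<le> ennreal (1 - \<eta>) * V (2 * t)" if "0 < t" for t
  proof (cases "V (2 * t) = top")
    case True
    then show ?thesis using \<eta> by (simp add: ennreal_mult_top)
  next
    case False
    have "ennreal \<eta> * V (2 * t) \<le> ennreal \<eta> * (ennreal ((C + 1) * (2 * t) powr p) * ?\<Psi> (2 * t))"
      using V_le[of "2 * t"] that by (intro mult_left_mono) auto
    also have "\<dots> = ennreal (\<eta> * ((C + 1) * (2 * t) powr p)) * ?\<Psi> (2 * t)"
      using \<eta> \<open>0 < C\<close> by (subst mult.assoc[symmetric], subst ennreal_mult[symmetric]) auto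
    also have "\<eta> * ((C + 1) * (2 * t) powr p) = (2 powr p - 1) * t powr p"
    proof -
      have "\<eta> * ((C + 1) * (2 * t) powr p) = \<eta> * ((C + 1) * 2 powr p) * t powr p"
        using that by (simp add: powr_mult)
      also have "\<eta> * ((C + 1) * 2 powr p) = 2 powr p - 1"
        using \<open>0 < C\<close> by (simp add: \<eta>_def)
      finally show ?thesis .
    qed
    finally have "V t + ennreal \<eta> * V (2 * t) \<le> V (2 * t)"
      using V_step[OF that] by (meson add_left_mono order_trans)
    also have "V (2 * t) = (ennreal (1 - \<eta>) + ennreal \<eta>) * V (2 * t)"
      using \<eta> by (subst ennreal_plus[symmetric]) auto
    also have "\<dots> = ennreal (1 - \<eta>) * V (2 * t) + ennreal \<eta> * V (2 * t)"
      by (rule distrib_right)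
    finally show ?thesis
      using False by (simp add: ennreal_add_left_cancel_le add.commute ennreal_mult_eq_top_iff)
  qed
  have V_iter: "V t \<le> ennreal ((1 - \<eta>) ^ n) * V (2 ^ n * t)" if "0 < t" for t n
  proof (induction n)
    case (Suc n)
    note Suc
    also have "ennreal ((1 - \<eta>) ^ n) * V (2 ^ n * t)
        \<le> ennreal ((1 - \<eta>) ^ n) * (ennreal (1 - \<eta>) * V (2 * (2 ^ n * t)))"
      using that by (intro mult_left_mono V_contract) auto
    also have "\<dots> = ennreal ((1 - \<eta>) ^ Suc n) * V (2 ^ Suc n * t)"
      using \<eta> by (subst mult.assoc[symmetric], subst ennreal_mult[symmetric]) (auto simp: ac_simps)
    finally show ?case .
  qed simp
  \<comment> \<open>The tail times t^p is at most V(t), the contraction is applied \<open>n\<close>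
    times, and \<open>V_le\<close> returns from V(2^n t) to the tail at 2^n t. Dividing by t^p
    leaves the rate for \<theta> = 1 - \<eta>.\<close>
  have "?\<Psi> t \<le> ennreal ((C + 1) * ((1 - \<eta>) * 2 powr p) ^ n) * ?\<Psi> (2 ^ n * t)" if "0 < t" for t n
  proof -
    have "ennreal (t powr p) * ?\<Psi> t \<le> V t"
      unfolding V_def by simp
    also have "\<dots> \<le> ennreal ((1 - \<eta>) ^ n) * (ennreal ((C + 1) * (2 ^ n * t) powr p) * ?\<Psi> (2 ^ n * t))"
      using that by (intro order_trans[OF V_iter[of t n]] mult_left_mono V_le) auto
    also have "\<dots> = ennreal ((1 - \<eta>) ^ n * ((C + 1) * (2 ^ n * t) powr p)) * ?\<Psi> (2 ^ n * t)"
      using \<eta> \<open>0 < C\<close> by (subst mult.assoc[symmetric], subst ennreal_mult[symmetric]) auto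
    also have "(1 - \<eta>) ^ n * ((C + 1) * (2 ^ n * t) powr p) = t powr p * ((C + 1) * ((1 - \<eta>) * 2 powr p) ^ n)"
    proof -
      have "(2 ^ n * t) powr p = (2 powr p) ^ n * t powr p"
        using that by (simp add: powr_mult powr_power flip: powr_realpow) (simp add: powr_powr mult.commute)
      then show ?thesis by (simp only: power_mult_distrib mult_ac)
    qed
    also have "ennreal (t powr p * ((C + 1) * ((1 - \<eta>) * 2 powr p) ^ n)) * ?\<Psi> (2 ^ n * t)
        = ennreal (t powr p) * (ennreal ((C + 1) * ((1 - \<eta>) * 2 powr p) ^ n) * ?\<Psi> (2 ^ n * t))"
      using \<eta> \<open>0 < C\<close> by (subst mult.assoc[symmetric], subst ennreal_mult[symmetric]) auto
    finally show ?thesis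
      using that by (subst (asm) ennreal_mult_le_mult_iff) auto
  qed
  then show thesis using \<eta> by (intro that[of "1 - \<eta>"]) auto
qed

text \<open>Each \<open>b n\<close> is at most the p-th root of the sum of all p-th powers, and the
  weights form a geometric series. This treats p < 1 and p >= 1 alike.\<close>

lemma ennpowr_suminf_le:
  assumes "0 < p" "0 < q" "q < 1"
  shows "ennpowr (\<Sum>n. ennreal (q ^ n) * b n) p
    \<le> ennreal ((1 / (1 - q)) powr p) * (\<Sum>n. ennpowr (b n) p)"
proof -
  let ?S = "\<Sum>n. ennpowr (b n) p"
  have b_le: "b n \<le> ennpowr ?S (1 / p)" for n
  proof -
    have "ennpowr (b n) p \<le> ?S"
      using sum_le_suminf[OF summableI, of "{n}" "\<lambda>n. ennpowr (b n) p"] by simp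
    then have "ennpowr (ennpowr (b n) p) (1 / p) \<le> ennpowr ?S (1 / p)"
      using \<open>0 < p\<close> by (intro ennpowr_mono) auto
    then show ?thesis using \<open>0 < p\<close> by (simp add: ennpowr_ennpowr)
  qed
  have "(\<Sum>n. ennreal (q ^ n) * b n) \<le> (\<Sum>n. ennreal (q ^ n) * ennpowr ?S (1 / p))"
    by (intro suminf_le mult_left_mono b_le summableI) auto
  also have "\<dots> = (\<Sum>n. ennreal (q ^ n)) * ennpowr ?S (1 / p)"
    by simp
  also have "(\<Sum>n. ennreal (q ^ n)) = ennreal (1 / (1 - q))"
    using assms by (intro suminf_ennreal_eq geometric_sums) auto
  finally have "ennpowr (\<Sum>n. ennreal (q ^ n) * b n) p \<le> ennpowr (ennreal (1 / (1 - q)) * ennpowr ?S (1 / p)) p"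
    using \<open>0 < p\<close> by (rule ennpowr_mono)
  also have "\<dots> = ennreal ((1 / (1 - q)) powr p) * ?S"
    using assms by (simp add: ennpowr_mult ennpowr_ennreal ennpowr_ennpowr)
  finally show ?thesis .
qed

section \<open>Control of the running integral by the oscillation\<close>

lemma mono_on_ennpowr_osc:
  assumes "antimono g" "0 < p"
  shows "mono_on {0<..} (\<lambda>u. ennpowr (osc g u) p)"
  using mono_on_osc[OF assms(1)] assms(2) by (auto simp: mono_on_def intro: ennpowr_mono)

lemma measurable_osc:
  assumes g: "antimono g"
  shows "(\<lambda>u. osc g u * indicator {0<..} u) \<in> borel_measurable borel"
  by (rule borel_measurable_mono_on_ennreal[OF mono_on_osc[OF g]])

text \<open>The running integral is a series of oscillations dilated by 2^(n+1) with coefficients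
  2^(-n-1). In p-th power the dilation costs K (\<theta> 2^p)^(n+1); the coefficients cancel the
  powers of 2^p, and the gain \<theta>^(n+1) makes the series converge.\<close>

lemma average_le_osc:
  fixes k :: "real \<Rightarrow> ennreal"
  assumes [measurable]: "k \<in> borel_measurable borel" and "0 < p" "0 < \<theta>" "\<theta> < 1" "0 \<le> K"
    and tails: "\<And>t n. 0 < t \<Longrightarrow> (\<integral>\<^sup>+ s\<in>{t<..}. k s \<partial>lborel)
      \<le> ennreal (K * (\<theta> * 2 powr p) ^ n) * (\<integral>\<^sup>+ s\<in>{2 ^ n * t<..}. k s \<partial>lborel)"
  obtains D where "0 < D" "\<And>g. antimono g \<Longrightarrow> (g \<longlongrightarrow> 0) at_top \<Longrightarrow>
    (\<integral>\<^sup>+ u\<in>{0<..}. ennpowr (\<integral>\<^sup>+ s\<in>{0<..<u}. g s \<partial>lborel) p * k u \<partial>lborel)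
      \<le> ennreal D * (\<integral>\<^sup>+ u\<in>{0<..}. ennpowr (osc g u) p * k u \<partial>lborel)"
proof -
  \<comment> \<open>The gain is split in two: one factor \<open>r ^ n\<close> pays for the weights
    \<open>q ^ n\<close> that bring the p-th power inside the series, the other sums the resulting
    series.\<close>
  define r where "r = sqrt \<theta>"
  have r: "0 < r" "r < 1" "r\<^sup>2 = \<theta>"
    using assms by (auto simp: r_def)
  define q where "q = r powr (1 / p)"
  have q: "0 < q" "q < 1"
    using r \<open>0 < p\<close> powr_less_mono2[of "1 / p" r 1] by (auto simp: q_def)
  have qp: "(q ^ n) powr p = r ^ n" for n
  proof -
    have "(q ^ n) powr p = (q powr p) ^ n"
      using q by (simp add: powr_power flip: powr_realpow) (simp add: powr_powr mult.commute)
    then show ?thesis using r \<open>0 < p\<close> by (simp add: q_def powr_powr)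
  qed
  \<comment> \<open>The coefficient of the n-th oscillation after the weight \<open>q ^ n\<close> is
    taken out.\<close>
  define c where "c n = (1 / 2) ^ Suc n / q ^ n" for n
  have c: "0 < c n" for n using q by (simp add: c_def)
  have cp: "c n powr p * (K * (\<theta> * 2 powr p) ^ Suc n) = K * r\<^sup>2 * r ^ n" for n
  proof -
    have "((1 / 2) ^ Suc n) powr p = 1 / (2 powr p) ^ Suc n"
    proof -
      have "((1 / 2) ^ Suc n) powr p = 1 / (2 ^ Suc n) powr p"
        by (simp only: power_one_over powr_divide) simp
      also have "(2 ^ Suc n :: real) powr p = (2 powr p) ^ Suc n"
        by (subst powr_realpow[symmetric], simp, subst powr_power) (simp_all add: powr_powr mult.commute)
      finally show ?thesis .
    qed
    then have "c n powr p = 1 / (2 powr p) ^ Suc n / r ^ n"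
      using q by (simp add: c_def powr_divide qp del: power_Suc)
    then show ?thesis
      using r(1) r(3)[symmetric] by (simp add: power_mult_distrib field_simps power2_eq_square)
  qed
  \<comment> \<open>The summand 1 keeps \<open>D\<close> positive when \<open>K\<close> is
    0.\<close>
  define D where "D = (1 / (1 - q)) powr p * (K * r\<^sup>2 * (1 / (1 - r))) + 1"
  show thesis
  proof (rule that[of D])
    show "0 < D" unfolding D_def using r \<open>0 \<le> K\<close>
      by (intro add_nonneg_pos mult_nonneg_nonneg) auto
    fix g :: "real \<Rightarrow> ennreal" assume g: "antimono g" and lim: "(g \<longlongrightarrow> 0) at_top"
    let ?I = "\<integral>\<^sup>+ u\<in>{0<..}. ennpowr (osc g u) p * k u \<partial>lborel"
    define J where "J u = osc g u * indicator {0<..} u" for u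
    have [measurable]: "J \<in> borel_measurable borel"
      using measurable_osc[OF g] by (simp add: J_def[abs_def])
    have "(\<integral>\<^sup>+ u\<in>{0<..}. ennpowr (\<integral>\<^sup>+ s\<in>{0<..<u}. g s \<partial>lborel) p * k u \<partial>lborel)
        \<le> (\<integral>\<^sup>+ u. ennreal ((1 / (1 - q)) powr p) *
            (\<Sum>n. ennpowr (ennreal (c n) * J (2 ^ Suc n * u)) p * k u * indicator {0<..} u) \<partial>lborel)"
    proof (rule nn_integral_mono)
      fix u :: real
      show "ennpowr (\<integral>\<^sup>+ s\<in>{0<..<u}. g s \<partial>lborel) p * k u * indicator {0<..} u \<le> 
         ennreal ((1 / (1 - q)) powr p) *
            (\<Sum>n. ennpowr (ennreal (c n) * J (2 ^ Suc n * u)) p * k u * indicator {0<..} u)"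
      proof (cases "0 < u")
        case True
        have "(\<integral>\<^sup>+ s\<in>{0<..<u}. g s \<partial>lborel) \<le> (\<Sum>n. ennreal ((1 / 2) ^ Suc n) * osc g (2 ^ Suc n * u))"
          by (rule nn_integral_le_suminf_osc[OF g lim True])
        also have "\<dots> = (\<Sum>n. ennreal (q ^ n) * (ennreal (c n) * J (2 ^ Suc n * u)))"
        proof (rule suminf_cong)
          fix n
          have "ennreal (q ^ n) * ennreal (c n) = ennreal ((1 / 2) ^ Suc n)"
            using q by (subst ennreal_mult[symmetric]) (auto simp: c_def)
          moreover have "J (2 ^ Suc n * u) = osc g (2 ^ Suc n * u)"
            using True by (simp add: J_def)
          ultimately show "ennreal ((1 / 2) ^ Suc n) * osc g (2 ^ Suc n * u)
              = ennreal (q ^ n) * (ennreal (c n) * J (2 ^ Suc n * u))"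
            by (simp only: mult.assoc[symmetric])
        qed
        finally have "ennpowr (\<integral>\<^sup>+ s\<in>{0<..<u}. g s \<partial>lborel) p
            \<le> ennpowr (\<Sum>n. ennreal (q ^ n) * (ennreal (c n) * J (2 ^ Suc n * u))) p"
          using \<open>0 < p\<close> by (rule ennpowr_mono)
        also have "\<dots> \<le> ennreal ((1 / (1 - q)) powr p) * (\<Sum>n. ennpowr (ennreal (c n) * J (2 ^ Suc n * u)) p)"
          using \<open>0 < p\<close> q by (rule ennpowr_suminf_le)
        finally have "ennpowr (\<integral>\<^sup>+ s\<in>{0<..<u}. g s \<partial>lborel) p * k u \<le> 
           ennreal ((1 / (1 - q)) powr p) * (\<Sum>n. ennpowr (ennreal (c n) * J (2 ^ Suc n * u)) p) * k u"
          by (rule mult_right_mono) simp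
        with True show ?thesis by (simp add: mult.assoc)
      qed simp
    qed
    also have "\<dots> = ennreal ((1 / (1 - q)) powr p) *
        (\<Sum>n. \<integral>\<^sup>+ u\<in>{0<..}. ennpowr (ennreal (c n) * J (2 ^ Suc n * u)) p * k u \<partial>lborel)"
      by (subst nn_integral_cmult, measurable, subst nn_integral_suminf) auto
    also have "\<dots> \<le> ennreal ((1 / (1 - q)) powr p) * (\<Sum>n. ennreal (K * r\<^sup>2 * r ^ n) * ?I)"
    proof (intro mult_left_mono suminf_le summableI)
      fix n
      have "(\<integral>\<^sup>+ u\<in>{0<..}. ennpowr (ennreal (c n) * J (2 ^ Suc n * u)) p * k u \<partial>lborel)
          = (\<integral>\<^sup>+ u. ennreal (c n powr p) * (ennpowr (J (2 ^ Suc n * u)) p * k u * indicator {0<..} u) \<partial>lborel)"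
        using c[of n] \<open>0 < p\<close>
        by (intro nn_integral_cong) (auto simp: ennpowr_mult ennpowr_ennreal mult.assoc)
      also have "\<dots> = ennreal (c n powr p) * (\<integral>\<^sup>+ u\<in>{0<..}. ennpowr (J (2 ^ Suc n * u)) p * k u \<partial>lborel)"
        by (rule nn_integral_cmult) measurable
      also have "(\<integral>\<^sup>+ u\<in>{0<..}. ennpowr (J (2 ^ Suc n * u)) p * k u \<partial>lborel)
          = (\<integral>\<^sup>+ u\<in>{0<..}. ennpowr (osc g (2 ^ Suc n * u)) p * k u \<partial>lborel)"
        by (intro nn_integral_cong) (auto simp: J_def split: split_indicator)
      also have "ennreal (c n powr p) * \<dots> \<le> ennreal (c n powr p) * (ennreal (K * (\<theta> * 2 powr p) ^ Suc n) * ?I)"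
        by (intro mult_left_mono nn_integral_dilation_le tails mono_on_ennpowr_osc g \<open>0 < p\<close>) auto
      also have "\<dots> = ennreal (c n powr p * (K * (\<theta> * 2 powr p) ^ Suc n)) * ?I"
        using \<open>0 \<le> K\<close> \<open>0 < \<theta>\<close> by (subst mult.assoc[symmetric], subst ennreal_mult[symmetric]) auto
      finally show "(\<integral>\<^sup>+ u\<in>{0<..}. ennpowr (ennreal (c n) * J (2 ^ Suc n * u)) p * k u \<partial>lborel)
          \<le> ennreal (K * r\<^sup>2 * r ^ n) * ?I"
        unfolding cp .
    qed auto
    also have "(\<Sum>n. ennreal (K * r\<^sup>2 * r ^ n) * ?I) = (\<Sum>n. ennreal (K * r\<^sup>2 * r ^ n)) * ?I"
      by simp
    also have "(\<Sum>n. ennreal (K * r\<^sup>2 * r ^ n)) = ennreal (K * r\<^sup>2 * (1 / (1 - r)))"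
      using r \<open>0 \<le> K\<close> by (intro suminf_ennreal_eq sums_mult geometric_sums) auto
    also have "ennreal ((1 / (1 - q)) powr p) * (ennreal (K * r\<^sup>2 * (1 / (1 - r))) * ?I)
        = ennreal ((1 / (1 - q)) powr p * (K * r\<^sup>2 * (1 / (1 - r)))) * ?I"
      using r \<open>0 \<le> K\<close> by (subst mult.assoc[symmetric], subst ennreal_mult[symmetric]) auto
    also have "\<dots> \<le> ennreal D * ?I"
      unfolding D_def by (intro mult_right_mono ennreal_leI) auto
    finally show "(\<integral>\<^sup>+ u\<in>{0<..}. ennpowr (\<integral>\<^sup>+ s\<in>{0<..<u}. g s \<partial>lborel) p * k u \<partial>lborel) \<le> ennreal D * ?I" .
  qed
qed

section \<open>Horizontal slices\<close>

text \<open>The amount of a value \<open>y\<close> that survives when only the levels in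
  \<open>L\<close> are kept, that is, the integral of the indicator of \<open>L\<close> from 0 to
  \<open>y\<close>. It is non-decreasing and 1-Lipschitz on the half-line.\<close>

definition slice_height :: "real set \<Rightarrow> real \<Rightarrow> real" where
  "slice_height L y = measure lborel (L \<inter> {0..<y})"

lemma emeasure_slice_height:
  assumes "L \<in> sets borel"
  shows "emeasure lborel (L \<inter> {0..<y}) = ennreal (slice_height L y)"
proof -
  have "emeasure lborel (L \<inter> {0..<y}) \<le> emeasure lborel {0..<y}"
    by (rule emeasure_mono) auto
  then have "emeasure lborel (L \<inter> {0..<y}) \<noteq> top"
    by (cases "0 \<le> y") (auto simp: top_unique)
  then show ?thesis unfolding slice_height_def by (rule emeasure_eq_ennreal_measure)
qed

lemma slice_height_nonneg [simp]: "0 \<le> slice_height L y"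
  by (simp add: slice_height_def)

lemma slice_height_add:
  assumes [measurable]: "L \<in> sets borel" and "0 \<le> y" "y \<le> z"
  shows "ennreal (slice_height L y) + (\<integral>\<^sup>+ x. indicator L x * indicator {y..<z} x \<partial>lborel) = ennreal (slice_height L z)"
proof -
  have "ennreal (slice_height L z) = (\<integral>\<^sup>+ x. indicator (L \<inter> {0..<z}) x \<partial>lborel)"
    by (simp add: emeasure_slice_height)
  also have "\<dots> = (\<integral>\<^sup>+ x. indicator (L \<inter> {0..<y}) x + indicator L x * indicator {y..<z} x \<partial>lborel)"
    using assms by (intro nn_integral_cong) (auto split: split_indicator)
  also have "\<dots> = ennreal (slice_height L y) + (\<integral>\<^sup>+ x. indicator L x * indicator {y..<z} x \<partial>lborel)"
    by (subst nn_integral_add) (auto simp: emeasure_slice_height)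
  finally show ?thesis by simp
qed

lemma mono_slice_height:
  assumes [measurable]: "L \<in> sets borel"
  shows "mono (slice_height L)"
proof
  fix y z :: real assume "y \<le> z"
  then have "emeasure lborel (L \<inter> {0..<y}) \<le> emeasure lborel (L \<inter> {0..<z})"
    by (intro emeasure_mono) auto
  then show "slice_height L y \<le> slice_height L z" by (simp add: emeasure_slice_height)
qed

lemma slice_height_Lipschitz:
  assumes [measurable]: "L \<in> sets borel" and "0 \<le> y" "y \<le> z"
  shows "slice_height L z \<le> slice_height L y + (z - y)"
proof -
  have "(\<integral>\<^sup>+ x. indicator L x * indicator {y..<z} x \<partial>lborel) \<le> (\<integral>\<^sup>+ x. indicator {y..<z} x \<partial>lborel)"
    by (intro nn_integral_mono) (auto split: split_indicator)
  also have "\<dots> = ennreal (z - y)" using assms by simp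
  finally have "ennreal (slice_height L z) \<le> ennreal (slice_height L y) + ennreal (z - y)"
    unfolding slice_height_add[OF assms, symmetric] by (rule add_left_mono)
  then show ?thesis
    using assms by (simp flip: ennreal_plus)
qed

lemma slice_height_zero [simp]: "slice_height L 0 = 0"
  by (simp add: slice_height_def)

lemma slice_height_UNIV: "0 \<le> y \<Longrightarrow> slice_height UNIV y = y"
  by (simp add: slice_height_def)

text \<open>Complementary sets of levels share out the whole interval from 0 to \<open>y\<close>;
  this is what makes the two slices of a function add up to it.\<close>

lemma slice_height_Compl:
  assumes [measurable]: "L \<in> sets borel" and "0 \<le> y"
  shows "slice_height L y + slice_height (- L) y = y"
proof -
  have "ennreal (slice_height L y) + ennreal (slice_height (- L) y)
      = emeasure lborel (L \<inter> {0..<y}) + emeasure lborel (- L \<inter> {0..<y})"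
    by (simp add: emeasure_slice_height)
  also have "\<dots> = emeasure lborel ((L \<inter> {0..<y}) \<union> (- L \<inter> {0..<y}))"
    by (rule plus_emeasure) auto
  also have "(L \<inter> {0..<y}) \<union> (- L \<inter> {0..<y}) = {0..<y}" by auto
  finally have "ennreal (slice_height L y + slice_height (- L) y) = ennreal y"
    using assms by simp
  then show ?thesis
    using assms by (simp only: ennreal_inj add_nonneg_nonneg slice_height_nonneg)
qed

text \<open>Keeps only the horizontal slices of \<open>f\<close> at the levels in \<open>L\<close>.\<close>
definition slice :: "real set \<Rightarrow> ('a \<Rightarrow> ereal) \<Rightarrow> 'a \<Rightarrow> ereal" where
  "slice L f x = (if 0 \<le> f x then ereal (slice_height L (real_of_ereal \<bar>f x\<bar>))
     else - ereal (slice_height L (real_of_ereal \<bar>f x\<bar>)))"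

text \<open>Slices are always finite: \<open>real_of_ereal\<close> sends infinite values of
  \<open>f\<close> to 0, so the slice vanishes there. This is harmless when \<open>f\<close> is
  finite almost everywhere.\<close>

lemma abs_slice: "\<bar>slice L f x\<bar> = ereal (slice_height L (real_of_ereal \<bar>f x\<bar>))"
  by (simp add: slice_def)

lemma measurable_slice [measurable]:
  assumes [measurable]: "f \<in> borel_measurable M" "L \<in> sets borel"
  shows "slice L f \<in> borel_measurable M"
proof -
  have [measurable]: "slice_height L \<in> borel_measurable borel"
    by (intro borel_measurable_mono mono_slice_height) simp
  show ?thesis unfolding slice_def[abs_def] by measurable
qed

text \<open>The set of infinite values lies in every superlevel set, and the one at level
  \<open>rearr M f t\<close> has measure at most \<open>t\<close>, with \<open>t\<close> arbitrarily
  small.\<close>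

lemma AE_finite_of_rearr:
  assumes [measurable]: "f \<in> borel_measurable M"
    and fin: "\<And>t. 0 < t \<Longrightarrow> rearr M f t < top"
  shows "AE x in M. \<bar>f x\<bar> \<noteq> \<infinity>"
proof -
  have small: "emeasure M {x \<in> space M. \<bar>f x\<bar> = \<infinity>} \<le> ennreal t" if t: "0 < t" for t
  proof -
    obtain a where a: "0 \<le> a" "rearr M f t = ennreal a"
      using fin[OF t] by (cases "rearr M f t") auto
    have "emeasure M {x \<in> space M. \<bar>f x\<bar> = \<infinity>} \<le> level_measure M f a"
      unfolding level_measure_def by (intro emeasure_mono) auto
    also have "\<dots> \<le> ennreal t"
      using a by (simp add: rearr_le_iff[symmetric])
    finally show ?thesis .
  qed
  have "emeasure M {x \<in> space M. \<bar>f x\<bar> = \<infinity>} \<le> 0"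
  proof (rule ennreal_le_epsilon)
    fix t :: real assume "0 < t"
    then show "emeasure M {x \<in> space M. \<bar>f x\<bar> = \<infinity>} \<le> 0 + ennreal t"
      using small by simp
  qed
  then show ?thesis
    by (intro AE_I[of _ _ "{x \<in> space M. \<bar>f x\<bar> = \<infinity>}"]) auto
qed

text \<open>Rearrangement commutes with a non-decreasing continuous function of |f|. Monotonicity of
  the height gives the upper bound, its Lipschitz continuity the lower bound.\<close>

lemma rearr_slice:
  assumes [measurable]: "f \<in> borel_measurable M" "L \<in> sets borel"
    and fin: "\<And>t. 0 < t \<Longrightarrow> rearr M f t < top" and "0 < t"
  shows "rearr M (slice L f) t = ennreal (slice_height L (enn2real (rearr M f t)))"
proof -
  obtain r where r: "0 \<le> r" "rearr M f t = ennreal r"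
    using fin[OF \<open>0 < t\<close>] by (cases "rearr M f t") auto
  have ae: "AE x in M. \<bar>f x\<bar> \<noteq> \<infinity>"
    by (rule AE_finite_of_rearr[OF assms(1) fin])
  have "rearr M (slice L f) t \<le> ennreal (slice_height L r)"
  proof -
    have "level_measure M (slice L f) (slice_height L r) \<le> level_measure M f r"
      unfolding level_measure_def
    proof (rule emeasure_mono_AE)
      show "AE x in M. x \<in> {x \<in> space M. ereal (slice_height L r) < \<bar>slice L f x\<bar>} \<longrightarrow>
          x \<in> {x \<in> space M. ereal r < \<bar>f x\<bar>}"
        using ae
      proof eventually_elim
        case (elim x)
        then obtain y where y: "\<bar>f x\<bar> = ereal y" by (cases "\<bar>f x\<bar>") auto
        then show ?case
          using monoD[OF mono_slice_height[of L], of y r] by (auto simp: abs_slice not_le[symmetric])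
      qed
    qed measurable
    also have "\<dots> \<le> ennreal t"
      using r by (simp add: rearr_le_iff[symmetric])
    finally show ?thesis by (simp add: rearr_le_iff)
  qed
  moreover have "ennreal (slice_height L r) \<le> rearr M (slice L f) t"
  proof (rule ccontr)
    assume "\<not> ?thesis"
    then have less: "rearr M (slice L f) t < ennreal (slice_height L r)" by simp
    then obtain l where l: "0 \<le> l" "rearr M (slice L f) t = ennreal l" "l < slice_height L r"
      by (cases "rearr M (slice L f) t") (auto simp: ennreal_less_iff)
    \<comment> \<open>Lowering the level by half of the gap lowers the height by at most half of the
      gap, so the height at \<open>y\<close> still exceeds \<open>l\<close>.\<close>
    define y where "y = r - (slice_height L r - l) / 2"
    have "slice_height L r \<le> r"
      using slice_height_Lipschitz[of L 0 r] r by simp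
    then have y: "0 \<le> y" "y < r"
      using l by (auto simp: y_def field_simps)
    then have "l < slice_height L y"
      using slice_height_Lipschitz[of L y r] l by (auto simp: y_def field_simps)
    have "ennreal t < level_measure M f y"
      using y r by (subst less_rearr_iff[symmetric]) (auto simp: ennreal_less_iff)
    also have "\<dots> \<le> level_measure M (slice L f) l"
      unfolding level_measure_def
    proof (rule emeasure_mono_AE)
      show "AE x in M. x \<in> {x \<in> space M. ereal y < \<bar>f x\<bar>} \<longrightarrow>
          x \<in> {x \<in> space M. ereal l < \<bar>slice L f x\<bar>}"
        using ae
      proof eventually_elim
        case (elim x)
        then obtain z where z: "\<bar>f x\<bar> = ereal z" by (cases "\<bar>f x\<bar>") auto
        then show ?case
          using monoD[OF mono_slice_height[of L], of y z] \<open>l < slice_height L y\<close> by (auto simp: abs_slice)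
      qed
    qed measurable
    also have "\<dots> \<le> ennreal t"
      using l by (simp add: rearr_le_iff[symmetric])
    finally show False by simp
  qed
  ultimately show ?thesis using r by simp
qed

text \<open>The oscillation at \<open>u\<close> is the area under the sliced rearrangement on (0, u)
  above its value at \<open>u\<close>. Fubini computes it horizontally: at a level \<open>y\<close>
  >= f*(u) in \<open>L\<close>, the points s with f*(s) > y form an interval of length
  \<open>level_measure M f y\<close>.\<close>

lemma osc_slice:
  assumes [measurable]: "f \<in> borel_measurable M" "L \<in> sets borel"
    and fin: "\<And>t. 0 < t \<Longrightarrow> rearr M f t < top" and "0 < u"
  shows "osc (rearr M (slice L f)) u
    = (\<integral>\<^sup>+ y\<in>{enn2real (rearr M f u)..}. level_measure M f y * indicator L y \<partial>lborel)"
proof -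
  define r where "r s = enn2real (rearr M f s)" for s
  have [measurable]: "r \<in> borel_measurable borel"
    unfolding r_def[abs_def] by measurable
  have [measurable]: "level_measure M f \<in> borel_measurable borel"
    by (rule borel_measurable_antimono_ennreal[OF antimono_level_measure]) simp
  have [measurable]: "slice_height L \<in> borel_measurable borel"
    by (intro borel_measurable_mono mono_slice_height) simp
  have rearr_r: "rearr M f s = ennreal (r s)" if "0 < s" for s
    using fin[OF that] by (simp add: r_def)
  have r_mono: "r u \<le> r s" if "0 < s" "s < u" for s
    using antimonoD[OF antimono_rearr[of M f], of s u] that fin[of s] fin[of u]
    unfolding r_def by (intro enn2real_mono) auto
  have slice_r: "rearr M (slice L f) s = ennreal (slice_height L (r s))" if "0 < s" for s
    unfolding r_def by (rule rearr_slice[OF _ _ fin that]) auto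
  have "osc (rearr M (slice L f)) u
      = (\<integral>\<^sup>+ s\<in>{0<..<u}. ennreal (slice_height L (r s)) \<partial>lborel) - (\<integral>\<^sup>+ s\<in>{0<..<u}. ennreal (slice_height L (r u)) \<partial>lborel)"
  proof -
    have "(\<integral>\<^sup>+ s\<in>{0<..<u}. rearr M (slice L f) s \<partial>lborel) = (\<integral>\<^sup>+ s\<in>{0<..<u}. ennreal (slice_height L (r s)) \<partial>lborel)"
      by (intro nn_integral_cong) (auto simp: slice_r split: split_indicator)
    then show ?thesis
      using \<open>0 < u\<close> by (simp add: osc_def slice_r nn_integral_cmult mult.commute)
  qed
  also have "\<dots> = (\<integral>\<^sup>+ s. ennreal (slice_height L (r s)) * indicator {0<..<u} s - ennreal (slice_height L (r u)) * indicator {0<..<u} s \<partial>lborel)"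
  proof (rule nn_integral_diff[symmetric])
    show "(\<integral>\<^sup>+ s\<in>{0<..<u}. ennreal (slice_height L (r u)) \<partial>lborel) \<noteq> \<infinity>"
      using \<open>0 < u\<close> by (simp add: nn_integral_cmult ennreal_mult_eq_top_iff)
    show "AE s in lborel. ennreal (slice_height L (r u)) * indicator {0<..<u} s \<le> ennreal (slice_height L (r s)) * indicator {0<..<u} s"
      using monoD[OF mono_slice_height[of L]] r_mono by (auto split: split_indicator)
  qed measurable
  also have "\<dots> = (\<integral>\<^sup>+ s. (\<integral>\<^sup>+ y. (if 0 < s \<and> s < u \<and> r u \<le> y \<and> y < r s then indicator L y else 0) \<partial>lborel) \<partial>lborel)"
  proof (rule nn_integral_cong)
    fix s
    show "ennreal (slice_height L (r s)) * indicator {0<..<u} s - ennreal (slice_height L (r u)) * indicator {0<..<u} s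
        = (\<integral>\<^sup>+ y. (if 0 < s \<and> s < u \<and> r u \<le> y \<and> y < r s then indicator L y else 0) \<partial>lborel)"
    proof (cases "0 < s \<and> s < u")
      case True
      have "(\<integral>\<^sup>+ y. (if 0 < s \<and> s < u \<and> r u \<le> y \<and> y < r s then indicator L y else 0) \<partial>lborel)
          = (\<integral>\<^sup>+ y. indicator L y * indicator {r u..<r s} y \<partial>lborel)"
        using True by (intro nn_integral_cong) (auto split: split_indicator)
      moreover have "ennreal (slice_height L (r s)) = ennreal (slice_height L (r u)) + (\<integral>\<^sup>+ y. indicator L y * indicator {r u..<r s} y \<partial>lborel)"
        using r_mono True by (intro slice_height_add[symmetric]) (auto simp: r_def)
      ultimately show ?thesis using True by simp
    next
      case False
      then have "(if 0 < s \<and> s < u \<and> r u \<le> y \<and> y < r s then indicator L y else 0) = (0::ennreal)" for y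
        by auto
      with False show ?thesis by (simp only: nn_integral_const) (auto split: split_indicator)
    qed
  qed
  also have "\<dots> = (\<integral>\<^sup>+ y. (\<integral>\<^sup>+ s. (if 0 < s \<and> s < u \<and> r u \<le> y \<and> y < r s then indicator L y else 0) \<partial>lborel) \<partial>lborel)"
    by (intro lborel_pair.Fubini'[symmetric]) measurable
  also have "\<dots> = (\<integral>\<^sup>+ y\<in>{r u..}. level_measure M f y * indicator L y \<partial>lborel)"
  proof (rule nn_integral_cong)
    fix y
    show "(\<integral>\<^sup>+ s. (if 0 < s \<and> s < u \<and> r u \<le> y \<and> y < r s then indicator L y else 0) \<partial>lborel)
        = level_measure M f y * indicator L y * indicator {r u..} y"
    proof (cases "r u \<le> y \<and> y \<in> L")
      case True
      then have "0 \<le> y" using enn2real_nonneg[of "rearr M f u"] unfolding r_def by linarith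
      have "rearr M f u \<le> ennreal y"
        using True \<open>0 < u\<close> by (simp add: rearr_r ennreal_leI)
      then have "level_measure M f y \<le> ennreal u"
        using \<open>0 \<le> y\<close> by (simp add: rearr_le_iff)
      then obtain m where m: "0 \<le> m" "level_measure M f y = ennreal m" "m \<le> u"
        using \<open>0 < u\<close> by (cases "level_measure M f y") (auto simp: top_unique)
      \<comment> \<open>The exchange of level and measure identifies the admissible \<open>s\<close>
        as the interval (0, m); since \<open>m\<close> is at most \<open>u\<close>, the restriction
        to \<open>s < u\<close> is then automatic.\<close>
      have "y < r s \<longleftrightarrow> s < m" if "0 < s" for s
        using less_rearr_iff[of f M y s] \<open>0 \<le> y\<close> that m by (simp add: rearr_r ennreal_less_iff)
      then have "(\<integral>\<^sup>+ s. (if 0 < s \<and> s < u \<and> r u \<le> y \<and> y < r s then indicator L y else 0) \<partial>lborel)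
          = (\<integral>\<^sup>+ s. indicator {0<..<m} s \<partial>lborel)"
        using True m by (intro nn_integral_cong) (auto split: split_indicator)
      then show ?thesis using True m by simp
    next
      case False
      then have "(\<integral>\<^sup>+ s. (if 0 < s \<and> s < u \<and> r u \<le> y \<and> y < r s then indicator L y else 0) \<partial>lborel) = (\<integral>\<^sup>+ s. 0 \<partial>(lborel::real measure))"
        by (intro nn_integral_cong) (auto split: split_indicator)
      then show ?thesis using False by (auto split: split_indicator)
    qed
  qed
  finally show ?thesis by (simp add: r_def)
qed

text \<open>Keeping all levels does not change the rearrangement at positive arguments, so the slice
  formula applies with \<open>UNIV\<close>.\<close>

lemma osc_rearr_eq:
  assumes [measurable]: "f \<in> borel_measurable M"
    and fin: "\<And>t. 0 < t \<Longrightarrow> rearr M f t < top" and "0 < u"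
  shows "osc (rearr M f) u = (\<integral>\<^sup>+ y\<in>{enn2real (rearr M f u)..}. level_measure M f y \<partial>lborel)"
proof -
  have eq: "rearr M (slice UNIV f) s = rearr M f s" if "0 < s" for s
    using rearr_slice[OF _ _ fin that, of UNIV] fin[OF that] by (simp add: slice_height_UNIV)
  then have "(\<integral>\<^sup>+ s\<in>{0<..<u}. rearr M f s \<partial>lborel) = (\<integral>\<^sup>+ s\<in>{0<..<u}. rearr M (slice UNIV f) s \<partial>lborel)"
    by (intro nn_integral_cong) (auto split: split_indicator)
  then have "osc (rearr M f) u = osc (rearr M (slice UNIV f)) u"
    using eq[OF \<open>0 < u\<close>] by (simp add: osc_def)
  then show ?thesis using osc_slice[OF _ _ fin \<open>0 < u\<close>, of UNIV] by simp
qed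

text \<open>The tail bound is available only at levels in \<open>L\<close>, which need not have a
  least element above \<open>a\<close>. The integral is at most the tail from their infimum, and
  every tail starting strictly above the infimum is below one from a level in
  \<open>L\<close>.\<close>

lemma nn_integral_levels_le:
  assumes f [measurable]: "f \<in> borel_measurable M"
    and bound: "\<And>y. y \<in> L \<Longrightarrow> a \<le> y \<Longrightarrow> (\<integral>\<^sup>+ z\<in>{y..}. level_measure M f z \<partial>lborel) \<le> B"
  shows "(\<integral>\<^sup>+ y\<in>{a..}. level_measure M f y * indicator L y \<partial>lborel) \<le> B"
proof (cases "L \<inter> {a..} = {}")
  case True
  then have "(\<integral>\<^sup>+ y\<in>{a..}. level_measure M f y * indicator L y \<partial>lborel) = (\<integral>\<^sup>+ y. 0 \<partial>(lborel :: real measure))"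
    by (intro nn_integral_cong) (auto split: split_indicator)
  then show ?thesis by simp
next
  case False
  define b where "b = Inf (L \<inter> {a..})"
  have bdd: "bdd_below (L \<inter> {a..})" by (auto intro: bdd_belowI[of _ a])
  have "(\<integral>\<^sup>+ y\<in>{a..}. level_measure M f y * indicator L y \<partial>lborel) \<le> (\<integral>\<^sup>+ y\<in>{b..}. level_measure M f y \<partial>lborel)"
    using cInf_lower[OF _ bdd] unfolding b_def
    by (intro nn_integral_mono) (auto split: split_indicator)
  also have "\<dots> \<le> B"
  proof (rule nn_integral_atLeast_le_of_tails)
    show "level_measure M f \<in> borel_measurable borel"
      by (rule borel_measurable_antimono_ennreal[OF antimono_level_measure[OF f]])
    fix c assume "b < c"
    then obtain y where y: "y \<in> L" "a \<le> y" "y < c"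
      using cInf_lessD[OF False, of c] unfolding b_def by auto
    have "(\<integral>\<^sup>+ z\<in>{c<..}. level_measure M f z \<partial>lborel) \<le> (\<integral>\<^sup>+ z\<in>{y..}. level_measure M f z \<partial>lborel)"
      using y by (intro nn_integral_mono) (auto split: split_indicator)
    also have "\<dots> \<le> B" using y by (intro bound)
    finally show "(\<integral>\<^sup>+ z\<in>{c<..}. level_measure M f z \<partial>lborel) \<le> B" .
  qed
  finally show ?thesis .
qed

section \<open>The two decompositions\<close>

lemma class_A_nn_integral_finite:
  assumes "g \<in> class_A"
  shows "(\<integral>\<^sup>+ s\<in>{0<..<u}. g s \<partial>lborel) < top"
proof -
  have "emeasure lebesgue {0<..<u} < top"
    by (cases "0 \<le> u") auto
  moreover have "{0<..<u} \<in> sets lebesgue" "{0<..<u} \<subseteq> {0<..}"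
    by auto
  ultimately have "(\<integral>\<^sup>+ s\<in>{0<..<u}. g s \<partial>lebesgue) < top"
    using assms unfolding class_A_def L1_loc_nonneg_def by blast
  then show ?thesis by (simp add: nn_integral_completion)
qed

lemma class_A_rearr_finite:
  assumes "rearr M f \<in> class_A" "0 < t"
  shows "rearr M f t < top"
proof -
  have "ennreal t * rearr M f t \<noteq> top"
    using le_less_trans[OF mult_le_nn_integral[OF antimono_rearr, of t M f]
        class_A_nn_integral_finite[OF assms(1)]] assms(2)
    by auto
  then show ?thesis using assms(2) by (auto simp: ennreal_mult_eq_top_iff less_top)
qed

text \<open>Both terms are finite and the integral is the larger one, so subtraction in
  \<open>ereal\<close> agrees with the truncated one in \<open>osc\<close>.\<close>

lemma T_op_rearr:
  assumes A: "rearr M f \<in> class_A" and "0 < t"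
  shows "T_op (rearr M f) t = enn2ereal (osc (rearr M f) (1 / t))"
proof -
  have le: "ennreal (1 / t) * rearr M f (1 / t) \<le> (\<integral>\<^sup>+ s\<in>{0<..<1 / t}. rearr M f s \<partial>lborel)"
    using \<open>0 < t\<close> by (intro mult_le_nn_integral antimono_rearr) auto
  obtain a where a: "0 \<le> a" "(\<integral>\<^sup>+ s\<in>{0<..<1 / t}. rearr M f s \<partial>lborel) = ennreal a"
    using class_A_nn_integral_finite[OF A, of "1 / t"]
    by (cases "\<integral>\<^sup>+ s\<in>{0<..<1 / t}. rearr M f s \<partial>lborel") auto
  then obtain b where b: "0 \<le> b" "ennreal (1 / t) * rearr M f (1 / t) = ennreal b" "b \<le> a"
    using le by (cases "ennreal (1 / t) * rearr M f (1 / t)") (auto simp: top_unique)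
  show ?thesis
    unfolding T_op_def osc_def nn_integral_completion a(2) b(2)
    using a b by (simp add: ennreal_minus)
qed

lemma osc_rearr_finite:
  assumes "rearr M f \<in> class_A"
  shows "osc (rearr M f) u < top"
  using class_A_nn_integral_finite[OF assms] unfolding osc_def by (simp add: diff_less_top_ennreal)

section \<open>Rearrangement estimates on the half-line\<close>

lemma abs_add_le_ereal: "\<bar>a + b\<bar> \<le> \<bar>a\<bar> + \<bar>b :: ereal\<bar>"
  by (cases a; cases b) auto

text \<open>If the bound failed at \<open>t\<close>, it would fail on all of (0, t) by monotonicity,
  and almost every point there would have |h0| or |h1| above its rearrangement at
  \<open>t / 4\<close>. Such points have total measure at most \<open>t / 2\<close>; the quarter
  leaves room for this strict contradiction.\<close>

lemma antimono_le_rearr_add: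
  fixes q :: "real \<Rightarrow> ennreal"
  assumes q: "antimono_on {0<..} q"
    and [measurable]: "h0 \<in> borel_measurable (lebesgue_on {0<..})" "h1 \<in> borel_measurable (lebesgue_on {0<..})"
    and le: "AE x in lebesgue_on {0<..}. enn2ereal (q x) \<le> \<bar>h0 x\<bar> + \<bar>h1 x\<bar>" and "0 < t"
  shows "q t \<le> rearr (lebesgue_on {0<..}) h0 (t / 4) + rearr (lebesgue_on {0<..}) h1 (t / 4)"
proof (rule ccontr)
  let ?N = "lebesgue_on {0::real<..}"
  assume "\<not> ?thesis"
  then have less: "rearr ?N h0 (t / 4) + rearr ?N h1 (t / 4) < q t" by simp
  then have "rearr ?N h0 (t / 4) \<noteq> top" "rearr ?N h1 (t / 4) \<noteq> top"
    by auto
  then obtain a b where ab: "0 \<le> a" "rearr ?N h0 (t / 4) = ennreal a" "0 \<le> b" "rearr ?N h1 (t / 4) = ennreal b"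
    by (metis ennreal_cases)
  have sets: "{0<..<t} \<in> sets ?N"
    by (auto simp: sets_restrict_space_iff)
  have "ennreal t = emeasure ?N {0<..<t}"
    using \<open>0 < t\<close> by (subst emeasure_restrict_space) auto
  also have "\<dots> \<le> emeasure ?N ({x \<in> space ?N. ereal a < \<bar>h0 x\<bar>} \<union> {x \<in> space ?N. ereal b < \<bar>h1 x\<bar>})"
  proof (rule emeasure_mono_AE)
    show "AE x in ?N. x \<in> {0<..<t} \<longrightarrow> x \<in> {x \<in> space ?N. ereal a < \<bar>h0 x\<bar>} \<union> {x \<in> space ?N. ereal b < \<bar>h1 x\<bar>}"
      using le
    proof eventually_elim
      case (elim x)
      show ?case
      proof
        assume x: "x \<in> {0<..<t}"
        then have "ennreal (a + b) < q x"
          using less ab monotone_onD[OF q, of x t] by (auto intro: less_le_trans)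
        then have "ereal (a + b) < enn2ereal (q x)"
          using ab by (simp add: less_ennreal.rep_eq flip: ennreal_plus)
        then have "ereal (a + b) < \<bar>h0 x\<bar> + \<bar>h1 x\<bar>"
          using elim by (rule less_le_trans)
        moreover have "\<bar>h0 x\<bar> + \<bar>h1 x\<bar> \<le> ereal (a + b)" if "\<bar>h0 x\<bar> \<le> ereal a" "\<bar>h1 x\<bar> \<le> ereal b"
          using add_mono[OF that] by simp
        ultimately show "x \<in> {x \<in> space ?N. ereal a < \<bar>h0 x\<bar>} \<union> {x \<in> space ?N. ereal b < \<bar>h1 x\<bar>}"
          using x by (force simp: space_restrict_space)
      qed
    qed
  qed measurable
  also have "\<dots> \<le> level_measure ?N h0 a + level_measure ?N h1 b"
    unfolding level_measure_def by (rule emeasure_subadditive) measurable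
  also have "\<dots> \<le> ennreal (t / 4) + ennreal (t / 4)"
    using ab by (intro add_mono) (auto simp: rearr_le_iff[symmetric])
  also have "\<dots> = ennreal (t / 2)"
    using \<open>0 < t\<close> by (subst ennreal_plus[symmetric]) auto
  finally show False
    using \<open>0 < t\<close> by simp
qed

text \<open>For finite \<open>q t\<close>, the points where |h| exceeds it all lie in (0, t), which
  has measure \<open>t\<close>.\<close>

lemma rearr_le_antimono:
  fixes q :: "real \<Rightarrow> ennreal"
  assumes q: "antimono_on {0<..} q"
    and [measurable]: "h \<in> borel_measurable (lebesgue_on {0<..})"
    and le: "\<And>x. 0 < x \<Longrightarrow> \<bar>h x\<bar> \<le> enn2ereal (q x)" and "0 < t"
  shows "rearr (lebesgue_on {0<..}) h t \<le> q t"
proof (cases "q t")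
  case (real a)
  have "level_measure (lebesgue_on {0<..}) h a \<le> emeasure (lebesgue_on {0<..}) {0<..<t}"
    unfolding level_measure_def
  proof (rule emeasure_mono)
    show "{x \<in> space (lebesgue_on {0<..}). ereal a < \<bar>h x\<bar>} \<subseteq> {0<..<t}"
    proof
      fix x assume "x \<in> {x \<in> space (lebesgue_on {0<..}). ereal a < \<bar>h x\<bar>}"
      then have x: "0 < x" "ereal a < \<bar>h x\<bar>" by (auto simp: space_restrict_space)
      have "x < t"
      proof (rule ccontr)
        assume "\<not> x < t"
        then have "q x \<le> q t" using monotone_onD[OF q, of t x] \<open>0 < t\<close> by auto
        then have "enn2ereal (q x) \<le> ereal a" using real by (simp add: less_eq_ennreal.rep_eq)
        then show False using le[OF x(1)] x(2) by simp
      qed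
      then show "x \<in> {0<..<t}" using x by simp
    qed
  qed (auto simp: sets_restrict_space_iff)
  also have "\<dots> = ennreal t"
    using \<open>0 < t\<close> by (subst emeasure_restrict_space) auto
  finally show ?thesis
    using real by (simp add: rearr_le_iff)
qed simp

lemma antimono_inverse:
  assumes "mono_on {0<..} H" "0 < c"
  shows "antimono_on {0<..} (\<lambda>t::real. H (c / t) :: ennreal)"
proof (rule monotone_onI)
  fix s t :: real assume "s \<in> {0<..}" "t \<in> {0<..}" "s \<le> t"
  then show "H (c / t) \<le> H (c / s)"
    using assms(2) by (intro mono_onD[OF assms(1)]) (auto simp: field_simps)
qed

section \<open>Splitting \<open>f\<close> and splitting its image under \<open>T_op\<close>\<close>

text \<open>Each level \<open>y\<close> of \<open>f\<close> goes to the piece whose bound \<open>H u\<close> is the larger one at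
  \<open>u = level_measure M f y\<close>.\<close>
lemma S_decomposition:
  assumes f [measurable]: "f \<in> borel_measurable M" and A: "rearr M f \<in> class_A"
    and H: "mono_on {0<..} H0" "mono_on {0<..} H1"
    and le: "\<And>u. 0 < u \<Longrightarrow> osc (rearr M f) u \<le> H0 u + H1 u"
  obtains f0 f1 where "f0 \<in> borel_measurable M" "f1 \<in> borel_measurable M" "decomposes M f f0 f1"
    "(rearr M f0 \<longlongrightarrow> 0) at_top" "(rearr M f1 \<longlongrightarrow> 0) at_top"
    "\<And>u. 0 < u \<Longrightarrow> osc (rearr M f0) u \<le> 2 * H0 u" "\<And>u. 0 < u \<Longrightarrow> osc (rearr M f1) u \<le> 2 * H1 u"
proof -
  note fin = class_A_rearr_finite[OF A]
  let ?m = "\<lambda>y. enn2real (level_measure M f y)"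
  define J0 where "J0 u = H0 u * indicator {0<..} u" for u
  define J1 where "J1 u = H1 u * indicator {0<..} u" for u
  have [measurable]: "J0 \<in> borel_measurable borel" "J1 \<in> borel_measurable borel"
    using H[THEN borel_measurable_mono_on_ennreal] by (simp_all add: J0_def[abs_def] J1_def[abs_def])
  have [measurable]: "level_measure M f \<in> borel_measurable borel"
    by (rule borel_measurable_antimono_ennreal[OF antimono_level_measure[OF f]])
  \<comment> \<open>Levels of infinite measure have \<open>?m y = 0\<close> and fall into
    \<open>L\<close>, as do levels of measure 0. Neither kind affects the oscillations: the former
    never reach f*(u) for u > 0, the latter have zero integrand.\<close>
  define L where "L = {y. J1 (?m y) \<le> J0 (?m y)}"
  have [measurable]: "L \<in> sets borel" unfolding L_def by measurable
  \<comment> \<open>A level \<open>y\<close> of the piece with y >= f*(u) has measure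
    \<open>v\<close> at most \<open>u\<close>. Since f*(v) <= y, the measures of the levels from
    \<open>y\<close> upwards integrate to at most the oscillation of f* at \<open>v\<close>. There
    the majorant of the piece is the larger one, and its monotonicity leads from \<open>v\<close> to
    \<open>u\<close>.\<close>
  have bound: "osc (rearr M (slice L' f)) u \<le> 2 * H u"
    if L' [measurable]: "L' \<in> sets borel" and "0 < u" and H: "mono_on {0<..} H"
      and larger: "\<And>y. y \<in> L' \<Longrightarrow> 0 < ?m y \<Longrightarrow> H0 (?m y) + H1 (?m y) \<le> 2 * H (?m y)" for L' u H
  proof -
    have "osc (rearr M (slice L' f)) u
        = (\<integral>\<^sup>+ y\<in>{enn2real (rearr M f u)..}. level_measure M f y * indicator L' y \<partial>lborel)"
      by (rule osc_slice[OF _ _ fin \<open>0 < u\<close>]) auto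
    also have "\<dots> \<le> 2 * H u"
    proof (rule nn_integral_levels_le[OF f])
      fix y assume y: "y \<in> L'" "enn2real (rearr M f u) \<le> y"
      have "0 \<le> y" using y(2) enn2real_nonneg order_trans by blast
      have "rearr M f u \<le> ennreal y"
        using y(2) fin[OF \<open>0 < u\<close>] by (cases "rearr M f u") (auto intro: ennreal_leI)
      then have "level_measure M f y \<le> ennreal u"
        using \<open>0 \<le> y\<close> by (simp add: rearr_le_iff)
      then obtain v where v: "0 \<le> v" "level_measure M f y = ennreal v" "v \<le> u"
        using \<open>0 < u\<close> by (cases "level_measure M f y") (auto simp: top_unique)
      show "(\<integral>\<^sup>+ z\<in>{y..}. level_measure M f z \<partial>lborel) \<le> 2 * H u"
      proof (cases "v = 0")
        \<comment> \<open>The majorants are controlled only at positive arguments. At measure 0 all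
          levels from \<open>y\<close> upwards have measure 0 and the integral vanishes.\<close>
        case True
        have "level_measure M f z * indicator {y..} z = 0" for z
          using antimonoD[OF antimono_level_measure[OF f], of y z] v True
          by (auto split: split_indicator)
        then show ?thesis by (simp only: nn_integral_const mult_zero_left zero_le)
      next
        case False
        then have "0 < v" using v by simp
        have "rearr M f v \<le> ennreal y"
          using v \<open>0 \<le> y\<close> by (simp add: rearr_le_iff)
        then have "enn2real (rearr M f v) \<le> y"
          using \<open>0 \<le> y\<close> by (simp add: enn2real_leI)
        then have "(\<integral>\<^sup>+ z\<in>{y..}. level_measure M f z \<partial>lborel)
            \<le> (\<integral>\<^sup>+ z\<in>{enn2real (rearr M f v)..}. level_measure M f z \<partial>lborel)"
          by (intro nn_integral_mono) (auto split: split_indicator)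
        also have "\<dots> = osc (rearr M f) v"
          by (rule osc_rearr_eq[OF f fin \<open>0 < v\<close>, symmetric])
        also have "\<dots> \<le> H0 v + H1 v" by (rule le[OF \<open>0 < v\<close>])
        also have "\<dots> \<le> 2 * H v" using larger[OF y(1)] v \<open>0 < v\<close> by simp
        also have "\<dots> \<le> 2 * H u"
          using mono_onD[OF H, of v u] \<open>0 < v\<close> \<open>0 < u\<close> v by (intro mult_left_mono) auto
        finally show ?thesis .
      qed
    qed
    finally show ?thesis .
  qed
  have lim: "(rearr M (slice L' f) \<longlongrightarrow> 0) at_top" if [measurable]: "L' \<in> sets borel" for L'
  proof (rule tendsto_sandwich[of "\<lambda>_. 0" _ _ "rearr M f"])
    show "\<forall>\<^sub>F t in at_top. rearr M (slice L' f) t \<le> rearr M f t"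
      using eventually_gt_at_top[of 0]
    proof eventually_elim
      case (elim t)
      have "slice_height L' (enn2real (rearr M f t)) \<le> enn2real (rearr M f t)"
        using slice_height_Lipschitz[of L' 0 "enn2real (rearr M f t)"] by simp
      then have "ennreal (slice_height L' (enn2real (rearr M f t))) \<le> ennreal (enn2real (rearr M f t))"
        by (rule ennreal_leI)
      then show ?case
        using rearr_slice[OF f that fin elim] fin[OF elim] by simp
    qed
    show "(rearr M f \<longlongrightarrow> 0) at_top" using A by (simp add: class_A_def)
  qed auto
  have "AE x in M. \<bar>f x\<bar> \<noteq> \<infinity>"
    by (rule AE_finite_of_rearr[OF f fin])
  then have "decomposes M f (slice L f) (slice (- L) f)"
    unfolding decomposes_def
  proof eventually_elim
    case (elim x)
    then obtain y where "f x = ereal y" by (cases "f x") auto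
    then show ?case
      using slice_height_Compl[of L "\<bar>y\<bar>"] by (auto simp: slice_def)
  qed
  then show thesis
  proof (rule that[rotated 2])
    fix u :: real assume u: "0 < u"
    show "osc (rearr M (slice L f)) u \<le> 2 * H0 u"
    proof (rule bound[OF _ u H(1)])
      fix y assume "y \<in> L" "0 < ?m y"
      then have "H1 (?m y) \<le> H0 (?m y)" by (simp add: L_def J0_def J1_def)
      then show "H0 (?m y) + H1 (?m y) \<le> 2 * H0 (?m y)" by (simp add: mult_2 add_left_mono)
    qed simp
    show "osc (rearr M (slice (- L) f)) u \<le> 2 * H1 u"
    proof (rule bound[OF _ u H(2)])
      fix y assume "y \<in> - L" "0 < ?m y"
      then have "H0 (?m y) \<le> H1 (?m y)" by (simp add: L_def J0_def J1_def)
      then show "H0 (?m y) + H1 (?m y) \<le> 2 * H1 (?m y)" by (simp add: mult_2 add_right_mono)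
    qed simp
  qed (auto intro!: lim)
qed

text \<open>Subadditivity of the oscillation bounds Tf* by a sum of two non-increasing functions,
  one built from \<open>f0\<close> and one from \<open>f1\<close>. Cutting Tf* at the first bound
  gives pieces below the two bounds, and rearrangement preserves a non-increasing majorant.\<close>

lemma Lambda_decomposition:
  assumes f [measurable]: "f \<in> borel_measurable M" and A: "rearr M f \<in> class_A"
    and [measurable]: "f0 \<in> borel_measurable M" "f1 \<in> borel_measurable M"
    and dec: "decomposes M f f0 f1"
  obtains h0 h1 where "h0 \<in> borel_measurable (lebesgue_on {0<..})" "h1 \<in> borel_measurable (lebesgue_on {0<..})"
    "decomposes (lebesgue_on {0<..}) (T_op (rearr M f)) h0 h1"
    "\<And>t. 0 < t \<Longrightarrow> rearr (lebesgue_on {0<..}) h0 t \<le> 3 * (\<integral>\<^sup>+ s\<in>{0<..<1 / t}. rearr M f0 s \<partial>lborel)"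
    "\<And>t. 0 < t \<Longrightarrow> rearr (lebesgue_on {0<..}) h1 t \<le> 2 * osc (rearr M f1) (2 / t)"
proof -
  let ?G = "\<lambda>u. 3 * (\<integral>\<^sup>+ s\<in>{0<..<u}. rearr M f0 s \<partial>lborel)"
  have osc_le: "osc (rearr M f) u \<le> ?G u + 2 * osc (rearr M f1) (2 * u)" if "0 < u" for u
  proof (rule osc_subadditive[OF antimono_rearr antimono_rearr antimono_rearr that class_A_nn_integral_finite[OF A]])
    fix s t :: real assume "0 < s" "0 < t"
    show "rearr M f (s + t) \<le> rearr M f0 s + rearr M f1 t"
    proof (rule rearr_add_le)
      show "AE x in M. \<bar>f x\<bar> \<le> \<bar>f0 x\<bar> + \<bar>f1 x\<bar>"
        using dec unfolding decomposes_def
        by eventually_elim (auto intro: abs_add_le_ereal)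
    qed (use \<open>0 < s\<close> \<open>0 < t\<close> in auto)
    \<comment> \<open>The decomposition is read as f1 = f - f0; pointwise this amounts to |f1| <=
      |f| + |f0|.\<close>
    show "rearr M f1 (s + t) \<le> rearr M f s + rearr M f0 t"
    proof (rule rearr_add_le)
      show "AE x in M. \<bar>f1 x\<bar> \<le> \<bar>f x\<bar> + \<bar>f0 x\<bar>"
        using dec unfolding decomposes_def
      proof eventually_elim
        case (elim x)
        then show ?case by (cases "f0 x"; cases "f1 x") auto
      qed
    qed (use \<open>0 < s\<close> \<open>0 < t\<close> in auto)
  qed
  have monoG: "mono_on {0<..} ?G"
    by (intro mono_onI mult_left_mono nn_integral_mono) (auto split: split_indicator)
  have monoF: "mono_on {0<..} (\<lambda>u. 2 * osc (rearr M f1) u)"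
    using mono_on_osc[OF antimono_rearr[of M f1]]
    by (intro mono_onI mult_left_mono) (auto simp: mono_on_def)
  define F where "F t = osc (rearr M f) (1 / t) * indicator {0<..} t" for t
  define G where "G t = ?G (1 / t) * indicator {0<..} t" for t
  have inv_measurable: "(\<lambda>t. H (1 / t) * indicator {0<..} t) \<in> borel_measurable borel"
    if "mono_on {0<..} H" for H :: "real \<Rightarrow> ennreal"
  proof -
    define J where "J u = H u * indicator {0<..} u" for u
    have [measurable]: "J \<in> borel_measurable borel"
      using borel_measurable_mono_on_ennreal[OF that] by (simp add: J_def[abs_def])
    have "(\<lambda>t. H (1 / t) * indicator {0<..} t) = (\<lambda>t. J (1 / t))"
      by (auto simp: J_def fun_eq_iff split: split_indicator)
    then show ?thesis by simp
  qed
  have [measurable]: "F \<in> borel_measurable borel" "G \<in> borel_measurable borel"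
    unfolding F_def[abs_def] G_def[abs_def]
    by (rule inv_measurable[OF mono_on_osc[OF antimono_rearr]], rule inv_measurable[OF monoG])
  \<comment> \<open>The cut takes place in \<open>ennreal\<close>, where the minimum and the
    truncated difference are nonnegative; finiteness of \<open>F\<close> excludes infinite values
    when passing to \<open>ereal\<close>.\<close>
  define h0 where "h0 t = enn2ereal (min (F t) (G t))" for t
  define h1 where "h1 t = enn2ereal (F t - min (F t) (G t))" for t
  have borel: "h0 \<in> borel_measurable borel" "h1 \<in> borel_measurable borel"
    unfolding h0_def[abs_def] h1_def[abs_def] by measurable
  have meas: "h \<in> borel_measurable (lebesgue_on {0<..})" if "h \<in> borel_measurable borel" for h :: "real \<Rightarrow> ereal"
    using that by (intro measurable_restrict_space1 measurable_completion) simp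
  have F_fin: "F t < top" for t
    using osc_rearr_finite[OF A, of "1 / t"] by (auto simp: F_def split: split_indicator)
  show thesis
  proof (rule that)
    show "h0 \<in> borel_measurable (lebesgue_on {0<..})" "h1 \<in> borel_measurable (lebesgue_on {0<..})"
      using borel by (auto intro: meas)
    show "decomposes (lebesgue_on {0<..}) (T_op (rearr M f)) h0 h1"
      unfolding decomposes_def
    proof (rule AE_I2)
      fix t assume "t \<in> space (lebesgue_on {0::real<..})"
      then have t: "0 < t" by (simp add: space_restrict_space)
      have "T_op (rearr M f) t = enn2ereal (F t)"
        using t by (simp add: T_op_rearr[OF A] F_def)
      also have "F t = min (F t) (G t) + (F t - min (F t) (G t))"
        by (rule ennreal_ineq_diff_add) simp
      also have "enn2ereal \<dots> = h0 t + h1 t"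
        unfolding h0_def h1_def by (rule plus_ennreal.rep_eq)
      finally have "T_op (rearr M f) t = h0 t + h1 t" .
      moreover have "\<bar>h0 t\<bar> \<noteq> \<infinity>"
      proof -
        have "min (F t) (G t) < top" using F_fin[of t] by (auto simp: min_less_iff_disj)
        then show ?thesis unfolding h0_def by (cases "min (F t) (G t)") auto
      qed
      ultimately show "\<not> (\<bar>h0 t\<bar> = \<infinity> \<and> h1 t = - h0 t) \<and> T_op (rearr M f) t = h0 t + h1 t"
        by simp
    qed
    fix t :: real assume "0 < t"
    show "rearr (lebesgue_on {0<..}) h0 t \<le> ?G (1 / t)"
    proof (rule rearr_le_antimono[OF antimono_inverse[OF monoG]])
      fix x :: real assume "0 < x"
      then show "\<bar>h0 x\<bar> \<le> enn2ereal (?G (1 / x))"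
        by (simp add: h0_def G_def min.coboundedI2 flip: less_eq_ennreal.rep_eq)
    qed (use \<open>0 < t\<close> borel in \<open>auto intro: meas\<close>)
    show "rearr (lebesgue_on {0<..}) h1 t \<le> 2 * osc (rearr M f1) (2 / t)"
    proof (rule rearr_le_antimono[OF antimono_inverse[OF monoF]])
      fix x :: real assume x: "0 < x"
      have "F x \<le> G x + 2 * osc (rearr M f1) (2 / x)"
        using osc_le[of "1 / x"] x by (simp add: F_def G_def)
      then have "F x - min (F x) (G x) \<le> 2 * osc (rearr M f1) (2 / x)"
        using F_fin[of x] by (auto simp: min_def ennreal_minus_le_iff)
      then show "\<bar>h1 x\<bar> \<le> enn2ereal (2 * osc (rearr M f1) (2 / x))"
        by (simp add: h1_def flip: less_eq_ennreal.rep_eq)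
    qed (use \<open>0 < t\<close> borel in \<open>auto intro: meas\<close>)
  qed
qed

text \<open>Every admissible decomposition of \<open>h\<close> is matched by one of \<open>f\<close>
  whose norms grow by at most the factor \<open>c\<close>, and the infimum inherits this
  factor.\<close>

lemma K_functional_le:
  assumes "0 < c" "0 \<le> t"
    and transfer: "\<And>h0 h1. h0 \<in> Y0 \<Longrightarrow> h1 \<in> Y1 \<Longrightarrow> decomposes N h h0 h1 \<Longrightarrow>
      \<exists>f0 f1. f0 \<in> X0 \<and> f1 \<in> X1 \<and> decomposes M f f0 f1 \<and>
        n0 f0 \<le> ennreal c * m0 h0 \<and> n1 f1 \<le> ennreal c * m1 h1"
  shows "K_functional M X0 n0 X1 n1 f t \<le> ennreal c * K_functional N Y0 m0 Y1 m1 h t"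
proof -
  have cancel: "ennreal c * (ennreal (1 / c) * x) = x" for x
    using \<open>0 < c\<close> by (subst mult.assoc[symmetric], subst ennreal_mult[symmetric]) auto
  \<comment> \<open>With the constant moved to the left, the right-hand side is a bare infimum,
    which also covers the case without any decomposition of \<open>h\<close>.\<close>
  have "ennreal (1 / c) * K_functional M X0 n0 X1 n1 f t \<le> K_functional N Y0 m0 Y1 m1 h t"
    unfolding K_functional_def[of N]
  proof (rule Inf_greatest, clarify)
    fix h0 h1 assume "h0 \<in> Y0" "h1 \<in> Y1" "decomposes N h h0 h1"
    from transfer[OF this] obtain f0 f1 where f: "f0 \<in> X0" "f1 \<in> X1" "decomposes M f f0 f1"
      and le: "n0 f0 \<le> ennreal c * m0 h0" "n1 f1 \<le> ennreal c * m1 h1"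
      by blast
    have "K_functional M X0 n0 X1 n1 f t \<le> n0 f0 + ennreal t * n1 f1"
      unfolding K_functional_def using f by (intro Inf_lower) blast
    also have "\<dots> \<le> ennreal c * m0 h0 + ennreal t * (ennreal c * m1 h1)"
      using le by (intro add_mono mult_left_mono) auto
    also have "\<dots> = ennreal c * (m0 h0 + ennreal t * m1 h1)"
      by (simp add: algebra_simps)
    finally have "ennreal (1 / c) * K_functional M X0 n0 X1 n1 f t
        \<le> ennreal (1 / c) * (ennreal c * (m0 h0 + ennreal t * m1 h1))"
      by (rule mult_left_mono) simp
    also have "\<dots> = m0 h0 + ennreal t * m1 h1"
      using cancel by (simp only: mult.left_commute)
    finally show "ennreal (1 / c) * K_functional M X0 n0 X1 n1 f t \<le> m0 h0 + ennreal t * m1 h1" .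
  qed
  then have "ennreal c * (ennreal (1 / c) * K_functional M X0 n0 X1 n1 f t)
      \<le> ennreal c * K_functional N Y0 m0 Y1 m1 h t"
    by (rule mult_left_mono) simp
  then show ?thesis by (simp only: cancel)
qed

section \<open>Equivalence of the K-functionals\<close>

lemma ennpowr_integral_le:
  assumes "I \<le> ennreal (c powr p) * I'" "0 < p" "0 \<le> c"
  shows "ennpowr I (1 / p) \<le> ennreal c * ennpowr I' (1 / p)"
  using ennpowr_le_cmult[OF assms(1), of "1 / p"] assms by (simp add: powr_powr)

lemma ennpowr_cmult_integral_le:
  fixes k :: "real \<Rightarrow> ennreal"
  assumes [measurable]: "k \<in> borel_measurable borel" and H: "mono_on {0<..} H" and "0 < p" "0 \<le> c"
    and le: "\<And>u. 0 < u \<Longrightarrow> F u \<le> ennreal c * H u"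
  shows "(\<integral>\<^sup>+ u\<in>{0<..}. ennpowr (F u) p * k u \<partial>lborel)
    \<le> ennreal (c powr p) * (\<integral>\<^sup>+ u\<in>{0<..}. ennpowr (H u) p * k u \<partial>lborel)"
proof -
  define J where "J u = H u * indicator {0<..} u" for u
  have [measurable]: "J \<in> borel_measurable borel"
    using borel_measurable_mono_on_ennreal[OF H] by (simp add: J_def[abs_def])
  have "(\<integral>\<^sup>+ u\<in>{0<..}. ennpowr (F u) p * k u \<partial>lborel)
      \<le> (\<integral>\<^sup>+ u. ennreal (c powr p) * (ennpowr (J u) p * k u) \<partial>lborel)"
  proof (rule nn_integral_mono)
    fix u
    have "ennpowr (F u) p \<le> ennreal (c powr p) * ennpowr (J u) p" if "0 < u"
      using ennpowr_le_cmult[OF le[OF that] \<open>0 < p\<close> \<open>0 \<le> c\<close>] that by (simp add: J_def)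
    then show "ennpowr (F u) p * k u * indicator {0<..} u \<le> ennreal (c powr p) * (ennpowr (J u) p * k u)"
      by (auto split: split_indicator simp: mult.assoc[symmetric] intro: mult_right_mono)
  qed
  also have "\<dots> = ennreal (c powr p) * (\<integral>\<^sup>+ u. ennpowr (J u) p * k u \<partial>lborel)"
    by (rule nn_integral_cmult) measurable
  also have "(\<integral>\<^sup>+ u. ennpowr (J u) p * k u \<partial>lborel) = (\<integral>\<^sup>+ u\<in>{0<..}. ennpowr (H u) p * k u \<partial>lborel)"
    by (intro nn_integral_cong) (auto simp: J_def split: split_indicator)
  finally show ?thesis .
qed

lemma mono_on_rearr_inverse: "0 < c \<Longrightarrow> mono_on {0<..} (\<lambda>u. rearr N h (1 / (c * u)))"
  by (intro mono_onI antimonoD[OF antimono_rearr]) (auto simp: field_simps)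

lemma mono_on_ennpowr:
  assumes "mono_on A H" "0 < p"
  shows "mono_on A (\<lambda>u. ennpowr (H u) p)"
  using assms by (auto simp: mono_on_def intro: ennpowr_mono)

text \<open>In kernel form the hypothesis bounds the oscillation by a dilation by 4 of the
  non-decreasing function h*(1/u). Two doublings of the tail remove it, whence the factor
  \<open>C * C\<close>.\<close>

lemma S_norm_le_Lambda_norm:
  assumes w: "weight w" and "0 < p" "0 < C"
    and doubling: "\<And>t. 0 < t \<Longrightarrow> psi p w t \<le> ennreal C * psi p w (2 * t)"
    and le: "\<And>u. 0 < u \<Longrightarrow> osc (rearr M f) u \<le> 2 * rearr N h (1 / (4 * u))"
  shows "S_norm M p w f \<le> ennreal (2 * (C * C)) * Lambda_norm N p (tilde_weight p w) h"
proof -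
  obtain k where k: "kernel p w k" using kernel_exists[OF w] .
  have [measurable]: "k \<in> borel_measurable borel" using k by (simp add: kernel_def)
  have tails: "(\<integral>\<^sup>+ s\<in>{t<..}. k s \<partial>lborel) \<le> ennreal (C powr p * C powr p) * (\<integral>\<^sup>+ s\<in>{4 * t<..}. k s \<partial>lborel)"
    if t: "0 < t" for t
  proof -
    have "(\<integral>\<^sup>+ s\<in>{t<..}. k s \<partial>lborel) \<le> ennreal (C powr p) * (\<integral>\<^sup>+ s\<in>{2 * t<..}. k s \<partial>lborel)"
      by (rule psi_doubling_kernel[OF k \<open>0 < p\<close> \<open>0 < C\<close> t doubling[OF t]])
    also have "\<dots> \<le> ennreal (C powr p) * (ennreal (C powr p) * (\<integral>\<^sup>+ s\<in>{2 * (2 * t)<..}. k s \<partial>lborel))"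
      using t by (intro mult_left_mono psi_doubling_kernel[OF k \<open>0 < p\<close> \<open>0 < C\<close>] doubling) auto
    finally show ?thesis by (simp add: mult.assoc ennreal_mult)
  qed
  let ?I = "\<integral>\<^sup>+ u\<in>{0<..}. ennpowr (rearr N h (1 / u)) p * k u \<partial>lborel"
  have mono: "mono_on {0<..} (\<lambda>u. ennpowr (rearr N h (1 / u)) p)"
    using mono_on_ennpowr[OF mono_on_rearr_inverse[of 1 N h] \<open>0 < p\<close>] by simp
  have "(\<integral>\<^sup>+ u\<in>{0<..}. ennpowr (osc (rearr M f) u) p * k u \<partial>lborel)
      \<le> ennreal (2 powr p) * (\<integral>\<^sup>+ u\<in>{0<..}. ennpowr (rearr N h (1 / (4 * u))) p * k u \<partial>lborel)"
    using le \<open>0 < p\<close> by (intro ennpowr_cmult_integral_le mono_on_rearr_inverse) auto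
  also have "\<dots> \<le> ennreal (2 powr p) * (ennreal (C powr p * C powr p) * ?I)"
    using tails by (intro mult_left_mono nn_integral_dilation_le[OF _ _ _ mono]) auto
  also have "\<dots> = ennreal ((2 * (C * C)) powr p) * ?I"
    using \<open>0 < C\<close> by (simp add: powr_mult ennreal_mult mult.assoc)
  finally show ?thesis
    unfolding S_norm_kernel[OF k \<open>0 < p\<close>] Lambda_norm_kernel[OF k \<open>0 < p\<close>]
    using \<open>0 < p\<close> by (rule ennpowr_integral_le) (use \<open>0 < C\<close> in simp)
qed

text \<open>After inversion the bound is the oscillation at \<open>2 * u\<close>, a single dilation
  by 2, which costs one doubling.\<close>

lemma Lambda_norm_le_S_norm:
  assumes w: "weight w" and "0 < p" "0 < C"
    and doubling: "\<And>t. 0 < t \<Longrightarrow> psi p w t \<le> ennreal C * psi p w (2 * t)"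
    and le: "\<And>t. 0 < t \<Longrightarrow> rearr N h t \<le> 2 * osc (rearr M f) (2 / t)"
  shows "Lambda_norm N p (tilde_weight p w) h \<le> ennreal (2 * C) * S_norm M p w f"
proof -
  obtain k where k: "kernel p w k" using kernel_exists[OF w] .
  have [measurable]: "k \<in> borel_measurable borel" using k by (simp add: kernel_def)
  have tails: "(\<integral>\<^sup>+ s\<in>{t<..}. k s \<partial>lborel) \<le> ennreal (C powr p) * (\<integral>\<^sup>+ s\<in>{2 * t<..}. k s \<partial>lborel)"
    if t: "0 < t" for t
    by (rule psi_doubling_kernel[OF k \<open>0 < p\<close> \<open>0 < C\<close> t doubling[OF t]])
  let ?I = "\<integral>\<^sup>+ u\<in>{0<..}. ennpowr (osc (rearr M f) u) p * k u \<partial>lborel"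
  have mono: "mono_on {0<..} (\<lambda>u. osc (rearr M f) (2 * u))"
    using mono_on_osc[OF antimono_rearr[of M f]] by (auto simp: mono_on_def)
  have "(\<integral>\<^sup>+ u\<in>{0<..}. ennpowr (rearr N h (1 / u)) p * k u \<partial>lborel)
      \<le> ennreal (2 powr p) * (\<integral>\<^sup>+ u\<in>{0<..}. ennpowr (osc (rearr M f) (2 * u)) p * k u \<partial>lborel)"
  proof (rule ennpowr_cmult_integral_le[OF _ mono \<open>0 < p\<close>])
    fix u :: real assume "0 < u"
    then show "rearr N h (1 / u) \<le> ennreal 2 * osc (rearr M f) (2 * u)"
      using le[of "1 / u"] by simp
  qed auto
  also have "\<dots> \<le> ennreal (2 powr p) * (ennreal (C powr p) * ?I)"
    using tails \<open>0 < p\<close>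
    by (intro mult_left_mono nn_integral_dilation_le[OF _ _ _ mono_on_ennpowr_osc[OF antimono_rearr]]) auto
  also have "\<dots> = ennreal ((2 * C) powr p) * ?I"
    using \<open>0 < C\<close> by (simp add: powr_mult ennreal_mult mult.assoc)
  finally show ?thesis
    unfolding S_norm_kernel[OF k \<open>0 < p\<close>] Lambda_norm_kernel[OF k \<open>0 < p\<close>]
    using \<open>0 < p\<close> by (rule ennpowr_integral_le) (use \<open>0 < C\<close> in simp)
qed

text \<open>The reverse doubling condition gives geometric growth control of the kernel's tails, and
  this bounds the running integral by the oscillation in norm. The measures and functions are
  quantified after \<open>D\<close>, which makes the constant uniform.\<close>

lemma Lambda_norm_le_S_norm_of_RB:
  fixes p :: real
  assumes w: "weight w" and "0 < p" and RB: "w \<in> RB p"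
  obtains D where "0 < D" "\<And>(M :: 'a measure) f (N :: 'b measure) h. (rearr M f \<longlongrightarrow> 0) at_top \<Longrightarrow>
    (\<And>t. 0 < t \<Longrightarrow> rearr N h t \<le> 3 * (\<integral>\<^sup>+ s\<in>{0<..<1 / t}. rearr M f s \<partial>lborel)) \<Longrightarrow>
    Lambda_norm N p (tilde_weight p w) h \<le> ennreal D * S_norm M p w f"
proof -
  obtain k where k: "kernel p w k" using kernel_exists[OF w] .
  have [measurable]: "k \<in> borel_measurable borel" using k by (simp add: kernel_def)
  obtain C where C: "0 < C" "\<And>t. 0 < t \<Longrightarrow> (\<integral>\<^sup>+ s\<in>{0<..<t}. ennreal (s powr p) * k s \<partial>lborel)
    \<le> ennreal (C * t powr p) * (\<integral>\<^sup>+ s\<in>{t<..}. k s \<partial>lborel)"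
    using RB_kernel[OF k RB] by blast
  obtain \<theta> where \<theta>: "0 < \<theta>" "\<theta> < 1" "\<And>t n. 0 < t \<Longrightarrow> (\<integral>\<^sup>+ s\<in>{t<..}. k s \<partial>lborel)
      \<le> ennreal ((C + 1) * (\<theta> * 2 powr p) ^ n) * (\<integral>\<^sup>+ s\<in>{2 ^ n * t<..}. k s \<partial>lborel)"
    using reverse_doubling_tails[OF _ \<open>0 < p\<close> C] by auto
  obtain B where B: "0 < B" "\<And>g. antimono g \<Longrightarrow> (g \<longlongrightarrow> 0) at_top \<Longrightarrow>
    (\<integral>\<^sup>+ u\<in>{0<..}. ennpowr (\<integral>\<^sup>+ s\<in>{0<..<u}. g s \<partial>lborel) p * k u \<partial>lborel)
      \<le> ennreal B * (\<integral>\<^sup>+ u\<in>{0<..}. ennpowr (osc g u) p * k u \<partial>lborel)"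
    using average_le_osc[OF _ \<open>0 < p\<close> \<theta>(1,2) _ \<theta>(3)] C(1) by auto
  show thesis
  proof (rule that[of "3 * B powr (1 / p)"])
    show "0 < 3 * B powr (1 / p)" using B(1) by simp
    fix M :: "'a measure" and f and N :: "'b measure" and h
    assume lim: "(rearr M f \<longlongrightarrow> 0) at_top"
      and le: "\<And>t. 0 < t \<Longrightarrow> rearr N h t \<le> 3 * (\<integral>\<^sup>+ s\<in>{0<..<1 / t}. rearr M f s \<partial>lborel)"
    let ?G = "\<lambda>u. \<integral>\<^sup>+ s\<in>{0<..<u}. rearr M f s \<partial>lborel"
    let ?I = "\<integral>\<^sup>+ u\<in>{0<..}. ennpowr (osc (rearr M f) u) p * k u \<partial>lborel"
    have mono: "mono_on {0<..} ?G"
      by (intro mono_onI nn_integral_mono) (auto split: split_indicator)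
    have "(\<integral>\<^sup>+ u\<in>{0<..}. ennpowr (rearr N h (1 / u)) p * k u \<partial>lborel)
        \<le> ennreal (3 powr p) * (\<integral>\<^sup>+ u\<in>{0<..}. ennpowr (?G u) p * k u \<partial>lborel)"
    proof (rule ennpowr_cmult_integral_le[OF _ mono \<open>0 < p\<close>])
      fix u :: real assume "0 < u"
      then show "rearr N h (1 / u) \<le> ennreal 3 * ?G u"
        using le[of "1 / u"] by simp
    qed auto
    also have "\<dots> \<le> ennreal (3 powr p) * (ennreal B * ?I)"
      by (intro mult_left_mono B(2) antimono_rearr lim) auto
    also have "\<dots> = ennreal ((3 * B powr (1 / p)) powr p) * ?I"
      using B(1) \<open>0 < p\<close> by (simp add: powr_mult powr_powr ennreal_mult mult.assoc)
    finally show "Lambda_norm N p (tilde_weight p w) h \<le> ennreal (3 * B powr (1 / p)) * S_norm M p w f"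
      unfolding S_norm_kernel[OF k \<open>0 < p\<close>] Lambda_norm_kernel[OF k \<open>0 < p\<close>]
      using \<open>0 < p\<close> by (rule ennpowr_integral_le) (use B(1) in simp)
  qed
qed

theorem theorem1p2:
  fixes M :: "'a measure" and p0 p1 :: real and w0 w1 :: "real \<Rightarrow> ennreal"
  assumes "sigma_finite_measure M" and "nonatomic M" and "0 < emeasure M (space M)"
    and "0 < p0" and "0 < p1"
    and "weight w0" and "weight w1"
    and "\<exists>C::real. C > 0 \<and> (\<forall>t>0. psi p0 w0 t \<le> ennreal C * psi p0 w0 (2 * t)
                               \<and> psi p1 w1 t \<le> ennreal C * psi p1 w1 (2 * t))"
    and "w0 \<in> RB p0"
  shows "\<exists>c d :: real. c > 0 \<and> d > 0 \<and>
    (\<forall>f \<in> borel_measurable M. rearr M f \<in> class_A \<longrightarrow> (\<forall>t>0.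
       K_S M p0 w0 p1 w1 f t
         \<le> ennreal c * K_Lambda (lebesgue_on {0<..}) p0 (tilde_weight p0 w0) p1 (tilde_weight p1 w1)
             (T_op (rearr M f)) t
     \<and> K_Lambda (lebesgue_on {0<..}) p0 (tilde_weight p0 w0) p1 (tilde_weight p1 w1)
             (T_op (rearr M f)) t
         \<le> ennreal d * K_S M p0 w0 p1 w1 f t))"
proof -
  let ?N = "lebesgue_on {0::real<..}"
  from assms(8) obtain C :: real where C: "0 < C"
    and dbl0: "\<And>t. 0 < t \<Longrightarrow> psi p0 w0 t \<le> ennreal C * psi p0 w0 (2 * t)"
    and dbl1: "\<And>t. 0 < t \<Longrightarrow> psi p1 w1 t \<le> ennreal C * psi p1 w1 (2 * t)"
    by blast
  obtain D where D: "0 < D" "\<And>(M :: 'a measure) f (N :: real measure) h. (rearr M f \<longlongrightarrow> 0) at_top \<Longrightarrow>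
    (\<And>t. 0 < t \<Longrightarrow> rearr N h t \<le> 3 * (\<integral>\<^sup>+ s\<in>{0<..<1 / t}. rearr M f s \<partial>lborel)) \<Longrightarrow>
    Lambda_norm N p0 (tilde_weight p0 w0) h \<le> ennreal D * S_norm M p0 w0 f"
    using Lambda_norm_le_S_norm_of_RB[OF assms(6,4,9), where 'a = 'a and 'b = real] by blast
  \<comment> \<open>Both pieces of \<open>f\<close> cost two doublings.\<close>
  define c where "c = 2 * (C * C)"
  \<comment> \<open>The first piece costs the reverse doubling constant \<open>D\<close>, the second
    one a single doubling; the maximum serves both.\<close>
  define d where "d = max D (2 * C)"
  have "0 < c" "0 < d" using C D(1) by (auto simp: c_def d_def)
  have "K_S M p0 w0 p1 w1 f t
         \<le> ennreal c * K_Lambda ?N p0 (tilde_weight p0 w0) p1 (tilde_weight p1 w1) (T_op (rearr M f)) t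
     \<and> K_Lambda ?N p0 (tilde_weight p0 w0) p1 (tilde_weight p1 w1) (T_op (rearr M f)) t
         \<le> ennreal d * K_S M p0 w0 p1 w1 f t"
    if f [measurable]: "f \<in> borel_measurable M" and A: "rearr M f \<in> class_A" and "0 < t" for f t
  proof
    show "K_S M p0 w0 p1 w1 f t
         \<le> ennreal c * K_Lambda ?N p0 (tilde_weight p0 w0) p1 (tilde_weight p1 w1) (T_op (rearr M f)) t"
      unfolding K_S_def K_Lambda_def
    proof (rule K_functional_le)
      fix h0 h1
      assume h: "h0 \<in> Lambda_space ?N p0 (tilde_weight p0 w0)" "h1 \<in> Lambda_space ?N p1 (tilde_weight p1 w1)"
        and dec: "decomposes ?N (T_op (rearr M f)) h0 h1"
      have [measurable]: "h0 \<in> borel_measurable ?N" "h1 \<in> borel_measurable ?N"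
        and fin: "Lambda_norm ?N p0 (tilde_weight p0 w0) h0 < top" "Lambda_norm ?N p1 (tilde_weight p1 w1) h1 < top"
        using h by (auto simp: Lambda_space_def)
      have ae: "AE x in ?N. enn2ereal (osc (rearr M f) (1 / x)) \<le> \<bar>h0 x\<bar> + \<bar>h1 x\<bar>"
        using dec AE_space unfolding decomposes_def
      proof eventually_elim
        case (elim x)
        then have "0 < x" by (simp add: space_restrict_space)
        then have "enn2ereal (osc (rearr M f) (1 / x)) = h0 x + h1 x"
          using elim by (simp add: T_op_rearr[OF A])
        also have "\<dots> \<le> \<bar>h0 x + h1 x\<bar>" by (cases "h0 x"; cases "h1 x") auto
        also have "\<dots> \<le> \<bar>h0 x\<bar> + \<bar>h1 x\<bar>" by (rule abs_add_le_ereal)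
        finally show ?case .
      qed
      \<comment> \<open>The half-line estimate is taken at the point \<open>1 / u\<close>, whose
        quarter is \<open>1 / (4 * u)\<close>.\<close>
      have "osc (rearr M f) u \<le> rearr ?N h0 (1 / (4 * u)) + rearr ?N h1 (1 / (4 * u))" if "0 < u" for u
        using antimono_le_rearr_add[OF antimono_inverse[OF mono_on_osc[OF antimono_rearr], of 1] _ _ ae, of "1 / u"] that
        by (simp add: mult.commute)
      then obtain f0 f1 where "f0 \<in> borel_measurable M" "f1 \<in> borel_measurable M" "decomposes M f f0 f1"
        "(rearr M f0 \<longlongrightarrow> 0) at_top" "(rearr M f1 \<longlongrightarrow> 0) at_top"
        and le0: "\<And>u. 0 < u \<Longrightarrow> osc (rearr M f0) u \<le> 2 * rearr ?N h0 (1 / (4 * u))"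
        and le1: "\<And>u. 0 < u \<Longrightarrow> osc (rearr M f1) u \<le> 2 * rearr ?N h1 (1 / (4 * u))"
        using S_decomposition[OF f A mono_on_rearr_inverse mono_on_rearr_inverse] by (metis zero_less_numeral)
      moreover have n0: "S_norm M p0 w0 f0 \<le> ennreal c * Lambda_norm ?N p0 (tilde_weight p0 w0) h0"
        unfolding c_def by (rule S_norm_le_Lambda_norm[OF assms(6,4) C dbl0 le0])
      moreover have n1: "S_norm M p1 w1 f1 \<le> ennreal c * Lambda_norm ?N p1 (tilde_weight p1 w1) h1"
        unfolding c_def by (rule S_norm_le_Lambda_norm[OF assms(7,5) C dbl1 le1])
      moreover have "S_norm M p0 w0 f0 < top" "S_norm M p1 w1 f1 < top"
        using le_less_trans[OF n0] le_less_trans[OF n1] fin by (auto simp: ennreal_mult_less_top)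
      ultimately show "\<exists>f0 f1. f0 \<in> S_space M p0 w0 \<and> f1 \<in> S_space M p1 w1 \<and> decomposes M f f0 f1 \<and>
          S_norm M p0 w0 f0 \<le> ennreal c * Lambda_norm ?N p0 (tilde_weight p0 w0) h0 \<and>
          S_norm M p1 w1 f1 \<le> ennreal c * Lambda_norm ?N p1 (tilde_weight p1 w1) h1"
        by (intro exI[of _ f0] exI[of _ f1]) (simp add: S_space_def)
    qed (use \<open>0 < c\<close> \<open>0 < t\<close> in auto)
    show "K_Lambda ?N p0 (tilde_weight p0 w0) p1 (tilde_weight p1 w1) (T_op (rearr M f)) t
         \<le> ennreal d * K_S M p0 w0 p1 w1 f t"
      unfolding K_S_def K_Lambda_def
    proof (rule K_functional_le)
      fix f0 f1
      assume f01: "f0 \<in> S_space M p0 w0" "f1 \<in> S_space M p1 w1" and dec: "decomposes M f f0 f1"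
      have [measurable]: "f0 \<in> borel_measurable M" "f1 \<in> borel_measurable M"
        and fin: "S_norm M p0 w0 f0 < top" "S_norm M p1 w1 f1 < top"
        and lim: "(rearr M f0 \<longlongrightarrow> 0) at_top"
        using f01 by (auto simp: S_space_def)
      obtain h0 h1 where h: "h0 \<in> borel_measurable ?N" "h1 \<in> borel_measurable ?N"
        "decomposes ?N (T_op (rearr M f)) h0 h1"
        and le0: "\<And>t. 0 < t \<Longrightarrow> rearr ?N h0 t \<le> 3 * (\<integral>\<^sup>+ s\<in>{0<..<1 / t}. rearr M f0 s \<partial>lborel)"
        and le1: "\<And>t. 0 < t \<Longrightarrow> rearr ?N h1 t \<le> 2 * osc (rearr M f1) (2 / t)"
        using Lambda_decomposition[OF f A _ _ dec] by auto
      have n0: "Lambda_norm ?N p0 (tilde_weight p0 w0) h0 \<le> ennreal d * S_norm M p0 w0 f0"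
        by (rule order_trans[OF D(2)[OF lim le0]]) (auto simp: d_def intro!: mult_right_mono ennreal_leI)
      have n1: "Lambda_norm ?N p1 (tilde_weight p1 w1) h1 \<le> ennreal d * S_norm M p1 w1 f1"
        by (rule order_trans[OF Lambda_norm_le_S_norm[OF assms(7,5) C dbl1 le1]])
           (auto simp: d_def intro!: mult_right_mono ennreal_leI)
      have "Lambda_norm ?N p0 (tilde_weight p0 w0) h0 < top" "Lambda_norm ?N p1 (tilde_weight p1 w1) h1 < top"
        using le_less_trans[OF n0] le_less_trans[OF n1] fin by (auto simp: ennreal_mult_less_top)
      with h n0 n1 show "\<exists>h0 h1. h0 \<in> Lambda_space ?N p0 (tilde_weight p0 w0) \<and>
          h1 \<in> Lambda_space ?N p1 (tilde_weight p1 w1) \<and> decomposes ?N (T_op (rearr M f)) h0 h1 \<and>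
          Lambda_norm ?N p0 (tilde_weight p0 w0) h0 \<le> ennreal d * S_norm M p0 w0 f0 \<and>
          Lambda_norm ?N p1 (tilde_weight p1 w1) h1 \<le> ennreal d * S_norm M p1 w1 f1"
        by (intro exI[of _ h0] exI[of _ h1]) (simp add: Lambda_space_def)
    qed (use \<open>0 < d\<close> \<open>0 < t\<close> in auto)
  qed
  with \<open>0 < c\<close> \<open>0 < d\<close> show ?thesis by blast
qed

end
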